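(* For $i=1,2$ let $J_i=\begin{pmatrix}\lambda_i-k_i&1\\k_i\lambda_i&0\end{pmatrix}$, where $\lambda_i,k_i$ are integers with $1\le k_i\le\lambda_i-1$. If $\operatorname{Prim}(k_1)=\operatorname{Prim}(k_2)$ and $\operatorname{Prim}(\lambda_1)=\operatorname{Prim}(\lambda_2)$, and $$\operatorname{Prim}(\lambda_i+k_i)\subseteq\operatorname{Prim}(\lambda_i)\cap\operatorname{Prim}(k_i)$$ for $i=1,2$, then $J_1$, $J_2$ define isomorphic algebras. Furthermore, in this case the dimension group is $$G\cong\mathbb{Z}\left[\tfrac1{\lambda_1}\right]\oplus\mathbb{Z}\left[\tfrac1{k_1}\right]$$ with positivity determined by positivity of the first coordinate (a nonzero element is positive if and only if its first coordinate is $>0$).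
   Context: $\operatorname{Prim}(n)$ is the set of prime factors of the positive integer $n$ ($\operatorname{Prim}(1)=\varnothing$). $J_i$ has Perron-Frobenius eigenvalue $\lambda_i$. The algebra defined by $J=J_i$ is the unital AF-algebra $\mathfrak{A}_J$ with constant incidence matrix $J$, i.e. the unital AF-algebra (unique up to isomorphism) whose ordered $K_0$-group with unit class is $G_J=\bigcup_{n\ge0}J^{-n}\mathbb{Z}^2\subset\mathbb{Q}^2$, where $g\ne0$ is positive iff $g_1+\frac1{\lambda_i}g_2>0$, and $[1]=(1,0)^t$. The dimension group is this ordered group. *)

theory Defs
  imports "HOL-Analysis.Analysis" "HOL-Computational_Algebra.Primes"
begin

section \<open>Unital C*-algebras\<close>

text \<open>
  Nonzero unital C*-algebras: the superclass fixes \<open>norm 1 = 1\<close>.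
\<close>

class cstar_algebra = real_normed_algebra_1 + banach +
  fixes cscale :: "complex \<Rightarrow> 'a \<Rightarrow> 'a"
    and adj :: "'a \<Rightarrow> 'a"
  assumes cscale_add_right: "cscale c (x + y) = cscale c x + cscale c y"
    and cscale_add_left: "cscale (c + d) x = cscale c x + cscale d x"
    and cscale_cscale: "cscale c (cscale d x) = cscale (c * d) x"
    and cscale_of_real: "cscale (complex_of_real r) x = r *\<^sub>R x"
    and cscale_mult_left: "cscale c x * y = cscale c (x * y)"
    and cscale_mult_right: "x * cscale c y = cscale c (x * y)"
    and norm_cscale: "norm (cscale c x) = cmod c * norm x"
    and adj_adj: "adj (adj x) = x"
    and adj_add: "adj (x + y) = adj x + adj y"
    and adj_cscale: "adj (cscale c x) = cscale (cnj c) (adj x)"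
    and adj_mult: "adj (x * y) = adj y * adj x"
    and cstar_identity: "norm (adj x * x) = (norm x)\<^sup>2"

definition star_isomorphism :: "('a::cstar_algebra \<Rightarrow> 'b::cstar_algebra) \<Rightarrow> bool" where
  "star_isomorphism f \<longleftrightarrow> bij f \<and>
     (\<forall>x y. f (x + y) = f x + f y) \<and>
     (\<forall>c x. f (cscale c x) = cscale c (f x)) \<and>
     (\<forall>x y. f (x * y) = f x * f y) \<and>
     (\<forall>x. f (adj x) = adj (f x))"

text \<open>A C*-algebra is here a type, so isomorphism is a relation between types.\<close>

definition cstar_isomorphic :: "'a::cstar_algebra itself \<Rightarrow> 'b::cstar_algebra itself \<Rightarrow> bool" where
  "cstar_isomorphic _ _ \<longleftrightarrow> (\<exists>f :: 'a \<Rightarrow> 'b. star_isomorphism f)"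


section \<open>AF-algebras with constant incidence matrix\<close>

text \<open>
  \<open>e j p q\<close> with \<open>p, q < d j\<close> are the matrix units of a copy of
  \<open>\<Oplus>\<^sub>j M\<^bsub>d j\<^esub>(\<complex>)\<close> containing the unit of the ambient algebra. The case \<open>d j = 0\<close>
  is a missing summand.
\<close>

definition matrix_units :: "('n::finite \<Rightarrow> nat) \<Rightarrow> ('n \<Rightarrow> nat \<Rightarrow> nat \<Rightarrow> 'a::cstar_algebra) \<Rightarrow> bool" where
  "matrix_units d e \<longleftrightarrow>
     (\<forall>i j. \<forall>p<d i. \<forall>q<d i. \<forall>r<d j. \<forall>s<d j.
        e i p q * e j r s = (if i = j \<and> q = r then e i p s else 0)) \<and>
     (\<forall>j. \<forall>p<d j. \<forall>q<d j. adj (e j p q) = e j q p) \<and>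
     (\<forall>j. \<forall>p<d j. e j p p \<noteq> 0) \<and>
     (\<Sum>j\<in>UNIV. \<Sum>p<d j. e j p p) = 1"

definition matrix_algebra :: "('n::finite \<Rightarrow> nat) \<Rightarrow> ('n \<Rightarrow> nat \<Rightarrow> nat \<Rightarrow> 'a::cstar_algebra) \<Rightarrow> 'a set" where
  "matrix_algebra d e =
     range (\<lambda>c. \<Sum>j\<in>UNIV. \<Sum>p<d j. \<Sum>q<d j. cscale (c j p q) (e j p q))"

text \<open>
  The inclusion of the algebra spanned by \<open>e\<close> into the one spanned by \<open>e'\<close> is block diagonal
  with multiplicities \<open>J\<close>: the \<open>i\<close>-th block of the image of \<open>\<Oplus>\<^sub>j a\<^sub>j\<close> is the block diagonal
  matrix in which each \<open>a\<^sub>j\<close> is repeated \<open>J $ i $ j\<close> times. The bijection \<open>\<sigma> i\<close> numbers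
  the rows of this block, the row \<open>(j, r, p)\<close> being row \<open>p\<close> of the \<open>r\<close>-th copy of \<open>a\<^sub>j\<close>.
\<close>

definition incidence ::
  "int^'n^'n \<Rightarrow> ('n::finite \<Rightarrow> nat) \<Rightarrow> ('n \<Rightarrow> nat \<Rightarrow> nat \<Rightarrow> 'a::cstar_algebra)
     \<Rightarrow> ('n \<Rightarrow> nat) \<Rightarrow> ('n \<Rightarrow> nat \<Rightarrow> nat \<Rightarrow> 'a) \<Rightarrow> bool" where
  "incidence J d e d' e' \<longleftrightarrow>
     (\<exists>\<sigma> :: 'n \<Rightarrow> 'n \<times> nat \<times> nat \<Rightarrow> nat.
        (\<forall>i. bij_betw (\<sigma> i) {(j, r, p). r < nat (J $ i $ j) \<and> p < d j} {..<d' i}) \<and>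
        (\<forall>j. \<forall>p<d j. \<forall>q<d j.
           e j p q = (\<Sum>i\<in>UNIV. \<Sum>r<nat (J $ i $ j). e' i (\<sigma> i (j, r, p)) (\<sigma> i (j, r, q)))))"

definition summand_size :: "int^'n^'n \<Rightarrow> int^'n \<Rightarrow> nat \<Rightarrow> 'n::finite \<Rightarrow> nat" where
  "summand_size J u n j = nat ((((*v) J ^^ n) u) $ j)"

text \<open>
  \<open>'a\<close> is the AF-algebra of the stationary Bratteli diagram with nonnegative incidence matrix
  \<open>J\<close> and with first level \<open>\<Oplus>\<^sub>j M\<^bsub>u $ j\<^esub>(\<complex>)\<close>; thus \<open>u\<close> is the class of the unit in \<open>K\<^sub>0\<close>,
  the limit of the system \<open>J : \<int>\<^sup>n \<rightarrow> \<int>\<^sup>n\<close>.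
\<close>

definition AF_with_incidence_matrix ::
  "'a::cstar_algebra itself \<Rightarrow> int^'n^'n \<Rightarrow> int^'n::finite \<Rightarrow> bool" where
  "AF_with_incidence_matrix _ J u \<longleftrightarrow>
     (\<exists>e :: nat \<Rightarrow> 'n \<Rightarrow> nat \<Rightarrow> nat \<Rightarrow> 'a.
        (\<forall>n. matrix_units (summand_size J u n) (e n)) \<and>
        (\<forall>n. incidence J (summand_size J u n) (e n) (summand_size J u (Suc n)) (e (Suc n))) \<and>
        closure (\<Union>n. matrix_algebra (summand_size J u n) (e n)) = UNIV)"


section \<open>Dimension groups\<close>

definition incidence_matrix :: "int \<Rightarrow> int \<Rightarrow> int^2^2" where
  "incidence_matrix k l = vector [vector [l - k, 1], vector [k * l, 0]]"

definition dimension_group :: "int^'n^'n \<Rightarrow> (rat^'n::finite) set" where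
  "dimension_group J =
     (\<Union>n. ((*v) (matrix_inv (\<chi> i j. rat_of_int (J $ i $ j))) ^^ n) ` {g. \<forall>i. g $ i \<in> \<int>})"

text \<open>
  \<open>(1, 1/l)\<close> is the left Perron-Frobenius eigenvector of \<open>incidence_matrix k l\<close>, with
  eigenvalue \<open>l\<close>. Positive cones are given without their element \<open>0\<close>.
\<close>

definition dimension_group_pos :: "int \<Rightarrow> int \<Rightarrow> (rat^2) set" where
  "dimension_group_pos k l =
     {g \<in> dimension_group (incidence_matrix k l). g $ 1 + 1 / rat_of_int l * g $ 2 > 0}"

definition Z_inverse :: "int \<Rightarrow> rat set" where
  "Z_inverse m = {of_int a / of_int m ^ n | a n. True}"

definition ordered_group_isomorphic ::
  "'a::ab_group_add set \<Rightarrow> 'a set \<Rightarrow> 'b::ab_group_add set \<Rightarrow> 'b set \<Rightarrow> bool" where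
  "ordered_group_isomorphic G G_pos H H_pos \<longleftrightarrow>
     (\<exists>f. bij_betw f G H \<and>
          (\<forall>x\<in>G. \<forall>y\<in>G. f (x + y) = f x + f y) \<and>
          (\<forall>x\<in>G. x \<in> G_pos \<longleftrightarrow> f x \<in> H_pos))"

end

theory Submission
  imports Defs
begin

text \<open>
  In the eigencoordinates \<open>x = g\<^sub>1 + g\<^sub>2 / l\<close>, \<open>y = g\<^sub>1 - g\<^sub>2 / k\<close> the matrix
  \<open>J = incidence_matrix k l\<close> acts as \<open>diag(l, -k)\<close>, and \<open>\<int>\<^sup>2\<close> becomes a lattice in
  \<open>\<int>[1/l] \<times> \<int>[1/k]\<close> that contains \<open>(k + l) (\<int> \<times> \<int>)\<close>. As the primes of \<open>k + l\<close> divide both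
  \<open>k\<close> and \<open>l\<close>, a power of \<open>J\<close> moves any given point of \<open>\<int>[1/l] \<times> \<int>[1/k]\<close> into this lattice.
  So the dimension group is \<open>\<int>[1/l] \<times> \<int>[1/k]\<close>, which depends only on the primes of \<open>k\<close> and
  \<open>l\<close>, and the class of the unit is \<open>(1, 1)\<close>.

  Hence the identity of the common dimension group is realised by positive integer matrices
  \<open>P\<^sub>i\<close>, \<open>Q\<^sub>i\<close> between levels of the two diagrams, with \<open>Q\<^sub>i P\<^sub>i\<close> and \<open>P\<^bsub>i+1\<^esub> Q\<^sub>i\<close> powers of
  \<open>J\<^sub>1\<close> and \<open>J\<^sub>2\<close>. A block diagonal inclusion with multiplicities \<open>Q P\<close> factors through an
  intermediate system of matrix units with multiplicities \<open>P\<close> and \<open>Q\<close>, so both algebras are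
  limits of the same diagram. Matching matrix units gives a *-isomorphism between dense
  *-subalgebras, isometric by the C*-identity, and it extends by continuity.
\<close>

section \<open>Isomorphisms from dense subalgebras\<close>

lemma cscale_simps [simp]:
  fixes x :: "'a::cstar_algebra"
  shows "cscale c (0::'a) = 0" "cscale 0 x = 0" "cscale 1 x = x" "cscale (- 1) x = - x"
    "adj (0::'a) = 0" "adj (1::'a) = 1"
proof -
  show "cscale c (0::'a) = 0" using cscale_add_right[of c "0::'a" 0] by simp
  show "cscale 0 x = 0" using cscale_add_left[of 0 0 x] by simp
  show "cscale 1 x = x" using cscale_of_real[of 1 x] by simp
  show "cscale (- 1) x = - x" using cscale_of_real[of "- 1" x] by simp
  show "adj (0::'a) = 0" using adj_add[of "0::'a" 0] by simp
  show "adj (1::'a) = 1" by (metis adj_adj adj_mult mult.left_neutral)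
qed

lemma cscale_sum: "cscale c (sum f A) = (\<Sum>x\<in>A. cscale c (f x :: 'a::cstar_algebra))"
  by (induction A rule: infinite_finite_induct) (auto simp: cscale_add_right)

lemma adj_sum: "adj (sum f A) = (\<Sum>x\<in>A. adj (f x :: 'a::cstar_algebra))"
  by (induction A rule: infinite_finite_induct) (auto simp: adj_add)

lemma adj_minus: "adj (x - y) = adj x - adj (y::'a::cstar_algebra)"
  by (metis add_diff_cancel_right' adj_add diff_add_cancel)

lemma cscale_minus: "cscale c (x - y) = cscale c x - cscale c (y::'a::cstar_algebra)"
  by (metis add_diff_cancel_right' cscale_add_right diff_add_cancel)

text \<open>The C*-identity and submultiplicativity bound the square of \<open>norm y\<close> by
  \<open>norm (adj y) * norm y\<close>. Cancelling one factor gives one inequality, and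
  \<open>adj x\<close> in place of \<open>y\<close> gives the other.\<close>

lemma norm_adj: "norm (adj x) = norm (x::'a::cstar_algebra)"
proof -
  have le: "norm y \<le> norm (adj y)" for y :: 'a
  proof (cases "y = 0")
    case False
    have "norm y * norm y \<le> norm (adj y) * norm y"
      using cstar_identity[of y] norm_mult_ineq[of "adj y" y] by (simp add: power2_eq_square)
    with False show ?thesis by simp
  qed simp
  show ?thesis using le[of x] le[of "adj x"] by (simp add: adj_adj)
qed

lemma tendsto_cscale:
  fixes f :: "'b \<Rightarrow> 'a::cstar_algebra"
  assumes "(f \<longlongrightarrow> a) F" shows "((\<lambda>x. cscale c (f x)) \<longlongrightarrow> cscale c a) F"
proof (rule Lim_transform_bound[where g = "\<lambda>x. cmod c *\<^sub>R (f x - a)", THEN Lim_null[THEN iffD2]])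
  show "\<forall>\<^sub>F x in F. norm (cscale c (f x) - cscale c a) \<le> norm (cmod c *\<^sub>R (f x - a))"
    by (simp add: norm_cscale flip: cscale_minus)
  show "((\<lambda>x. cmod c *\<^sub>R (f x - a)) \<longlongrightarrow> 0) F"
    using tendsto_scaleR[OF tendsto_const assms[THEN Lim_null[THEN iffD1]], of "cmod c"] by simp
qed

lemma tendsto_adj:
  fixes f :: "'b \<Rightarrow> 'a::cstar_algebra"
  assumes "(f \<longlongrightarrow> a) F" shows "((\<lambda>x. adj (f x)) \<longlongrightarrow> adj a) F"
proof (rule Lim_transform_bound[where g = "\<lambda>x. f x - a", THEN Lim_null[THEN iffD2]])
  show "\<forall>\<^sub>F x in F. norm (adj (f x) - adj a) \<le> norm (f x - a)"
    by (simp add: norm_adj flip: adj_minus)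
qed (use assms Lim_null in blast)

text \<open>The isomorphism is the closure of the graph \<open>R\<close>.\<close>

lemma cstar_isomorphic_of_dense_graph:
  fixes R :: "('a::cstar_algebra \<times> 'b::cstar_algebra) set"
  assumes add: "\<And>x y x' y'. (x, y) \<in> R \<Longrightarrow> (x', y') \<in> R \<Longrightarrow> (x + x', y + y') \<in> R"
    and cscale: "\<And>c x y. (x, y) \<in> R \<Longrightarrow> (cscale c x, cscale c y) \<in> R"
    and mult: "\<And>x y x' y'. (x, y) \<in> R \<Longrightarrow> (x', y') \<in> R \<Longrightarrow> (x * x', y * y') \<in> R"
    and adj: "\<And>x y. (x, y) \<in> R \<Longrightarrow> (adj x, adj y) \<in> R"
    and norm_eq: "\<And>x y. (x, y) \<in> R \<Longrightarrow> norm x = norm y"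
    and dense_fst: "closure (fst ` R) = UNIV"
    and dense_snd: "closure (snd ` R) = UNIV"
  shows "cstar_isomorphic TYPE('a) TYPE('b)"
proof -
  define G where "G = closure R"
  have G_iff: "(x, y) \<in> G \<longleftrightarrow> (\<exists>X Y. (\<forall>n. (X n, Y n) \<in> R) \<and> X \<longlonglongrightarrow> x \<and> Y \<longlonglongrightarrow> y)" for x y
  proof
    assume "(x, y) \<in> G"
    then obtain Z where Z: "\<And>n. Z n \<in> R" "Z \<longlonglongrightarrow> (x, y)"
      unfolding G_def closure_sequential by blast
    show "\<exists>X Y. (\<forall>n. (X n, Y n) \<in> R) \<and> X \<longlonglongrightarrow> x \<and> Y \<longlonglongrightarrow> y"
      using Z tendsto_fst[OF Z(2)] tendsto_snd[OF Z(2)]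
      by (intro exI[of _ "fst \<circ> Z"] exI[of _ "snd \<circ> Z"]) (simp add: comp_def)
  next
    assume "\<exists>X Y. (\<forall>n. (X n, Y n) \<in> R) \<and> X \<longlonglongrightarrow> x \<and> Y \<longlonglongrightarrow> y"
    then obtain X Y where "\<And>n. (X n, Y n) \<in> R" "X \<longlonglongrightarrow> x" "Y \<longlonglongrightarrow> y" by blast
    then show "(x, y) \<in> G"
      unfolding G_def closure_sequential by (intro exI[of _ "\<lambda>n. (X n, Y n)"]) (simp add: tendsto_Pair)
  qed
  have G_I: "(x, y) \<in> G"
    if "\<And>n. (X n, Y n) \<in> R" "X \<longlonglongrightarrow> x" "Y \<longlonglongrightarrow> y" for X Y x y
    using that G_iff by blast
  have G_add: "(x + x', y + y') \<in> G" and G_mult: "(x * x', y * y') \<in> G"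
    if xy: "(x, y) \<in> G" and xy': "(x', y') \<in> G" for x y x' y'
  proof -
    obtain X Y where X: "\<forall>n. (X n, Y n) \<in> R" "X \<longlonglongrightarrow> x" "Y \<longlonglongrightarrow> y"
      using xy unfolding G_iff by (elim exE conjE) (rule that, assumption+)
    obtain X' Y' where X': "\<forall>n. (X' n, Y' n) \<in> R" "X' \<longlonglongrightarrow> x'" "Y' \<longlonglongrightarrow> y'"
      using xy' unfolding G_iff by (elim exE conjE) (rule that, assumption+)
    show "(x + x', y + y') \<in> G"
      by (rule G_I[OF add[OF X(1)[rule_format] X'(1)[rule_format]] tendsto_add[OF X(2) X'(2)] tendsto_add[OF X(3) X'(3)]])
    show "(x * x', y * y') \<in> G"
      by (rule G_I[OF mult[OF X(1)[rule_format] X'(1)[rule_format]] tendsto_mult[OF X(2) X'(2)] tendsto_mult[OF X(3) X'(3)]])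
  qed
  have G_cscale: "(cscale c x, cscale c y) \<in> G" and G_adj: "(adj x, adj y) \<in> G"
    if xy: "(x, y) \<in> G" for c x y
  proof -
    obtain X Y where X: "\<forall>n. (X n, Y n) \<in> R" "X \<longlonglongrightarrow> x" "Y \<longlonglongrightarrow> y"
      using xy unfolding G_iff by (elim exE conjE) (rule that, assumption+)
    show "(cscale c x, cscale c y) \<in> G"
      by (rule G_I[OF cscale[OF X(1)[rule_format]] tendsto_cscale[OF X(2)] tendsto_cscale[OF X(3)]])
    show "(adj x, adj y) \<in> G"
      by (rule G_I[OF adj[OF X(1)[rule_format]] tendsto_adj[OF X(2)] tendsto_adj[OF X(3)]])
  qed
  have G_diff: "(x - x', y - y') \<in> G" if "(x, y) \<in> G" "(x', y') \<in> G" for x y x' y'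
    using G_add[OF that(1) G_cscale[OF that(2), of "- 1"]] by simp
  have G_norm: "norm x = norm y" if "(x, y) \<in> G" for x y
  proof -
    obtain X Y where X: "\<forall>n. (X n, Y n) \<in> R" "X \<longlonglongrightarrow> x" "Y \<longlonglongrightarrow> y"
      using \<open>(x, y) \<in> G\<close> unfolding G_iff by (elim exE conjE) (rule that, assumption+)
    show ?thesis
      using tendsto_norm[OF X(2)] tendsto_norm[OF X(3)] norm_eq[OF X(1)[rule_format]]
      by (simp add: LIMSEQ_unique)
  qed
  \<comment> \<open>By isometry, one coordinate of a difference in \<open>G\<close> vanishes iff the
    other does, so \<open>G\<close> is single-valued in both directions.\<close>
  have G_inj: "x = x' \<longleftrightarrow> y = y'" if "(x, y) \<in> G" "(x', y') \<in> G" for x y x' y'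
    using G_norm[OF G_diff[OF that]] by auto
  have R_norm_diff: "norm (x - x') = norm (y - y')" if "(x, y) \<in> R" "(x', y') \<in> R" for x y x' y'
    using that G_norm G_diff closure_subset unfolding G_def by blast
  \<comment> \<open>Along an approximating sequence in the domain of \<open>R\<close> the partners
    are Cauchy by isometry, so they converge by completeness of the target.\<close>
  have ex1: "\<exists>y. (x, y) \<in> G" for x
  proof -
    have "x \<in> closure (fst ` R)" using dense_fst by simp
    then obtain X where "\<forall>n. X n \<in> fst ` R" and X: "X \<longlonglongrightarrow> x" unfolding closure_sequential by blast
    then have "\<forall>n. \<exists>y. (X n, y) \<in> R" by force
    then obtain Y where Y: "\<And>n. (X n, Y n) \<in> R" by metis
    have "Cauchy X" using X LIMSEQ_imp_Cauchy by blast
    then have "Cauchy Y" unfolding Cauchy_def dist_norm using R_norm_diff[OF Y Y] by simp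
    then obtain y where "Y \<longlonglongrightarrow> y" using Cauchy_convergent convergent_def by blast
    then show ?thesis using G_I[OF Y X] by blast
  qed
  have ex2: "\<exists>x. (x, y) \<in> G" for y
  proof -
    have "y \<in> closure (snd ` R)" using dense_snd by simp
    then obtain Y where "\<forall>n. Y n \<in> snd ` R" and Y: "Y \<longlonglongrightarrow> y" unfolding closure_sequential by blast
    then have "\<forall>n. \<exists>x. (x, Y n) \<in> R" by force
    then obtain X where X: "\<And>n. (X n, Y n) \<in> R" by metis
    have "Cauchy Y" using Y LIMSEQ_imp_Cauchy by blast
    then have "Cauchy X" unfolding Cauchy_def dist_norm using R_norm_diff[OF X X] by simp
    then obtain x where "X \<longlonglongrightarrow> x" using Cauchy_convergent convergent_def by blast
    then show ?thesis using G_I[OF X _ Y] by blast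
  qed
  obtain f where f: "\<And>x. (x, f x) \<in> G" using ex1 by metis
  have f_eq: "f x = y" if "(x, y) \<in> G" for x y using G_inj[OF that f[of x]] by simp
  have "bij f"
    unfolding bij_def inj_def surj_def using G_inj[OF f f] f_eq ex2 by metis
  then have "star_isomorphism f"
    unfolding star_isomorphism_def using f f_eq G_add G_mult G_cscale G_adj by simp
  then show ?thesis unfolding cstar_isomorphic_def by blast
qed

section \<open>Contractivity of bounded *-homomorphisms\<close>

lemma norm_selfadjoint_power:
  fixes h :: "'a::cstar_algebra"
  assumes "adj h = h"
  shows "norm (h ^ 2 ^ n) = norm h ^ 2 ^ n"
proof (induction n)
  case (Suc n)
  have "adj (h ^ m) = h ^ m" for m
    by (induction m) (simp_all add: adj_mult assms power_commutes)
  then have "norm (h ^ 2 ^ Suc n) = (norm (h ^ 2 ^ n))\<^sup>2"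
    using cstar_identity[of "h ^ 2 ^ n"] by (simp add: power_mult power2_eq_square mult.commute[of 2])
  then show ?case using Suc by (metis mult.commute power_Suc power_mult)
qed simp

text \<open>
  A bounded *-homomorphism is contractive: the bound \<open>C\<close> applied to \<open>h ^ 2 ^ n\<close>
  with \<open>h = adj x * x\<close> is \<open>norm y ^ 2 ^ Suc n \<le> C * norm x ^ 2 ^ Suc n\<close>.
\<close>

lemma bounded_star_hom_contractive:
  fixes R :: "('a::cstar_algebra \<times> 'b::cstar_algebra) set"
  assumes mult: "\<And>x y x' y'. (x, y) \<in> R \<Longrightarrow> (x', y') \<in> R \<Longrightarrow> (x * x', y * y') \<in> R"
    and adj: "\<And>x y. (x, y) \<in> R \<Longrightarrow> (adj x, adj y) \<in> R"
    and bound: "\<And>x y. (x, y) \<in> R \<Longrightarrow> norm y \<le> C * norm x"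
    and xy: "(x, y) \<in> R"
  shows "norm y \<le> norm x"
proof (rule ccontr)
  assume less: "\<not> norm y \<le> norm x"
  \<comment> \<open>The exponent starts at 1, since \<open>R\<close> need not contain the pair of
    units.\<close>
  have hR: "((adj x * x) ^ Suc m, (adj y * y) ^ Suc m) \<in> R" for m
    by (induction m) (use mult adj xy in \<open>simp_all\<close>)
  have sa: "adj (adj z * z) = adj z * z" for z :: "'c::cstar_algebra" by (simp add: adj_mult adj_adj)
  define a b where "a = (norm x)\<^sup>2" and "b = (norm y)\<^sup>2"
  have ab: "b ^ 2 ^ n \<le> C * a ^ 2 ^ n" for n
  proof -
    obtain m where m: "2 ^ n = Suc m" by (metis Suc_pred pos2 zero_less_power)
    show ?thesis
      using bound[OF hR[of m]] norm_selfadjoint_power[OF sa, of x n] norm_selfadjoint_power[OF sa, of y n]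
      unfolding a_def b_def m[symmetric] by (simp add: cstar_identity)
  qed
  have "a \<ge> 0" "b > a" using less unfolding a_def b_def by (auto simp: power_strict_mono)
  show False
  proof (cases "a = 0")
    case True
    then show False using ab[of 0] \<open>b > a\<close> by simp
  next
    case False
    with \<open>a \<ge> 0\<close> have "a > 0" by simp
    then have "b / a > 1" using \<open>b > a\<close> by simp
    then obtain n where n: "C < (b / a) ^ n" using real_arch_pow by blast
    also have "\<dots> \<le> (b / a) ^ 2 ^ n" using \<open>b / a > 1\<close> less_exp[of n] by (intro power_increasing) auto
    finally have "C * a ^ 2 ^ n < b ^ 2 ^ n" using \<open>a > 0\<close> by (simp add: power_divide field_simps)
    then show False using ab[of n] by simp
  qed
qed

section \<open>Systems of matrix units\<close>

text \<open>The linear map matching \<open>e j p q\<close> with \<open>g j p q\<close>, kept as a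
  relation so that no linear independence has to be proved first; \<open>unit_graph_norm_eq\<close>
  shows later that it is isometric, hence a map.\<close>

definition unit_graph ::
  "('n::finite \<Rightarrow> nat) \<Rightarrow> ('n \<Rightarrow> nat \<Rightarrow> nat \<Rightarrow> 'a::cstar_algebra) \<Rightarrow> ('n \<Rightarrow> nat \<Rightarrow> nat \<Rightarrow> 'b::cstar_algebra)
     \<Rightarrow> ('a \<times> 'b) set" where
  "unit_graph d e g =
     range (\<lambda>c. (\<Sum>j\<in>UNIV. \<Sum>p<d j. \<Sum>q<d j. cscale (c j p q) (e j p q),
                 \<Sum>j\<in>UNIV. \<Sum>p<d j. \<Sum>q<d j. cscale (c j p q) (g j p q)))"

lemma fst_unit_graph: "fst ` unit_graph d e g = matrix_algebra d e"
  and snd_unit_graph: "snd ` unit_graph d e g = matrix_algebra d g"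
  unfolding unit_graph_def matrix_algebra_def by (simp_all add: image_image)

lemma unit_graph_E:
  assumes "(x, y) \<in> unit_graph d e g"
  obtains c where "x = (\<Sum>j\<in>UNIV. \<Sum>p<d j. \<Sum>q<d j. cscale (c j p q) (e j p q))"
    and "y = (\<Sum>j\<in>UNIV. \<Sum>p<d j. \<Sum>q<d j. cscale (c j p q) (g j p q))"
  using assms unfolding unit_graph_def by blast

lemma unit_graph_add:
  assumes "(x, y) \<in> unit_graph d e g" "(x', y') \<in> unit_graph d e g"
  shows "(x + x', y + y') \<in> unit_graph d e g"
proof -
  obtain c where c: "x = (\<Sum>j\<in>UNIV. \<Sum>p<d j. \<Sum>q<d j. cscale (c j p q) (e j p q))"
    "y = (\<Sum>j\<in>UNIV. \<Sum>p<d j. \<Sum>q<d j. cscale (c j p q) (g j p q))" using assms(1) by (rule unit_graph_E)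
  obtain c' where c': "x' = (\<Sum>j\<in>UNIV. \<Sum>p<d j. \<Sum>q<d j. cscale (c' j p q) (e j p q))"
    "y' = (\<Sum>j\<in>UNIV. \<Sum>p<d j. \<Sum>q<d j. cscale (c' j p q) (g j p q))" using assms(2) by (rule unit_graph_E)
  show ?thesis
    unfolding unit_graph_def c c'
    by (intro image_eqI[of _ _ "\<lambda>j p q. c j p q + c' j p q"]) (simp_all add: cscale_add_left sum.distrib)
qed

lemma unit_graph_cscale:
  assumes "(x, y) \<in> unit_graph d e g"
  shows "(cscale a x, cscale a y) \<in> unit_graph d e g"
proof -
  obtain c where c: "x = (\<Sum>j\<in>UNIV. \<Sum>p<d j. \<Sum>q<d j. cscale (c j p q) (e j p q))"
    "y = (\<Sum>j\<in>UNIV. \<Sum>p<d j. \<Sum>q<d j. cscale (c j p q) (g j p q))" using assms(1) by (rule unit_graph_E)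
  show ?thesis
    unfolding unit_graph_def c
    by (intro image_eqI[of _ _ "\<lambda>j p q. a * c j p q"]) (simp_all add: cscale_sum cscale_cscale)
qed

lemma unit_graph_zero: "(0, 0) \<in> unit_graph d e g"
  unfolding unit_graph_def by (intro image_eqI[of _ _ "\<lambda>j p q. 0"]) simp_all

lemma unit_graph_sum:
  assumes "\<And>a. a \<in> A \<Longrightarrow> (f a, h a) \<in> unit_graph d e g"
  shows "(sum f A, sum h A) \<in> unit_graph d e g"
  using assms
  by (induction A rule: infinite_finite_induct) (auto intro: unit_graph_add unit_graph_zero)

lemma sum_units_delta:
  fixes d :: "'n::finite \<Rightarrow> nat"
  assumes "p < d j" "q < d j"
  shows "(\<Sum>j'\<in>UNIV. \<Sum>p'<d j'. \<Sum>q'<d j'. if j' = j \<and> p' = p \<and> q' = q then F j' p' q' else 0)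
    = (F j p q :: 'a::comm_monoid_add)"
proof -
  have "(\<Sum>q'<d j'. if j' = j \<and> p' = p \<and> q' = q then F j' p' q' else 0)
      = (if p' = p then if j' = j then F j p q else 0 else 0)" for j' p'
    using assms by (cases "j' = j \<and> p' = p") auto
  moreover have "(\<Sum>p'<d j'. if p' = p then if j' = j then F j p q else 0 else 0)
      = (if j' = j then F j p q else 0)" for j'
    using assms by (cases "j' = j") auto
  ultimately show ?thesis by simp
qed

lemma unit_graph_unit:
  assumes "p < d j" "q < d j"
  shows "(e j p q, g j p q) \<in> unit_graph d e g"
proof -
  let ?c = "\<lambda>j' p' q'. if j' = j \<and> p' = p \<and> q' = q then 1 else 0 :: complex"
  have if_scale: "cscale (if P then 1 else 0) z = (if P then z else 0)" for P and z :: "'x::cstar_algebra"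
    by simp
  show ?thesis
    unfolding unit_graph_def
    by (rule image_eqI[of _ _ ?c]) (simp_all only: if_scale sum_units_delta[of p d j q, OF assms] UNIV_I)
qed

lemma unit_graph_subset:
  assumes "\<And>j p q. p < d j \<Longrightarrow> q < d j \<Longrightarrow> (e j p q, g j p q) \<in> unit_graph d' e' g'"
  shows "unit_graph d e g \<subseteq> unit_graph d' e' g'"
proof clarify
  fix x y assume "(x, y) \<in> unit_graph d e g"
  then show "(x, y) \<in> unit_graph d' e' g'"
    by (elim unit_graph_E) (auto intro!: assms unit_graph_sum unit_graph_cscale)
qed

text \<open>Both families obey the same multiplication table, so products of matched units are
  matched units or both 0; the rest is bilinearity.\<close>

lemma unit_graph_mult:
  assumes e: "matrix_units d e" and g: "matrix_units d g"
    and xy: "(x, y) \<in> unit_graph d e g" "(x', y') \<in> unit_graph d e g"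
  shows "(x * x', y * y') \<in> unit_graph d e g"
proof -
  have unit: "(e i p q * e j r s, g i p q * g j r s) \<in> unit_graph d e g"
    if "p < d i" "q < d i" "r < d j" "s < d j" for i p q j r s
    using that e g unfolding matrix_units_def by (auto intro: unit_graph_unit unit_graph_zero)
  obtain c where c: "x = (\<Sum>j\<in>UNIV. \<Sum>p<d j. \<Sum>q<d j. cscale (c j p q) (e j p q))"
    "y = (\<Sum>j\<in>UNIV. \<Sum>p<d j. \<Sum>q<d j. cscale (c j p q) (g j p q))" using xy(1) by (rule unit_graph_E)
  obtain c' where c': "x' = (\<Sum>j\<in>UNIV. \<Sum>p<d j. \<Sum>q<d j. cscale (c' j p q) (e j p q))"
    "y' = (\<Sum>j\<in>UNIV. \<Sum>p<d j. \<Sum>q<d j. cscale (c' j p q) (g j p q))" using xy(2) by (rule unit_graph_E)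
  show ?thesis
    unfolding c c' sum_distrib_left sum_distrib_right cscale_mult_left cscale_mult_right
    by (intro unit_graph_sum unit_graph_cscale unit) auto
qed

lemma unit_graph_adj:
  assumes e: "matrix_units d e" and g: "matrix_units d g" and xy: "(x, y) \<in> unit_graph d e g"
  shows "(adj x, adj y) \<in> unit_graph d e g"
proof -
  have unit: "(adj (e j p q), adj (g j p q)) \<in> unit_graph d e g"
    if "p < d j" "q < d j" for p q j
    using that e g unfolding matrix_units_def by (auto intro: unit_graph_unit)
  obtain c where c: "x = (\<Sum>j\<in>UNIV. \<Sum>p<d j. \<Sum>q<d j. cscale (c j p q) (e j p q))"
    "y = (\<Sum>j\<in>UNIV. \<Sum>p<d j. \<Sum>q<d j. cscale (c j p q) (g j p q))" using xy by (rule unit_graph_E)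
  show ?thesis
    unfolding c adj_sum adj_cscale by (intro unit_graph_sum unit_graph_cscale unit) auto
qed

section \<open>Norms in the span of matrix units\<close>

lemma norm_matrix_unit:
  assumes e: "matrix_units d e" and "p < d j" "q < d j"
  shows "norm (e j p q) = 1"
proof -
  have ne: "norm (e j q q) \<noteq> 0" using assms unfolding matrix_units_def by simp
  \<comment> \<open>A diagonal unit is a nonzero projection, so its norm equals its own square. The
    other units reduce to this through \<open>adj (e j p q) * e j p q = e j q q\<close>.\<close>
  have "(norm (e j q q))\<^sup>2 = norm (e j q q)"
    using cstar_identity[of "e j q q"] assms unfolding matrix_units_def by simp
  with ne have 1: "norm (e j q q) = 1" by (simp add: power2_eq_square)
  have "(norm (e j p q))\<^sup>2 = norm (e j q q)"
    using cstar_identity[of "e j p q"] assms unfolding matrix_units_def by simp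
  with 1 have "(norm (e j p q))\<^sup>2 = 1\<^sup>2" by simp
  then show ?thesis by (rule power2_eq_imp_eq) simp_all
qed

text \<open>Multiplying by the norm-one projections \<open>e j p p\<close> on the left and
  \<open>e j q q\<close> on the right isolates one coefficient.\<close>

lemma norm_coefficient_le:
  assumes e: "matrix_units d e" and pq: "p < d j" "q < d j"
    and x: "x = (\<Sum>j\<in>UNIV. \<Sum>p<d j. \<Sum>q<d j. cscale (c j p q) (e j p q))"
  shows "cmod (c j p q) \<le> norm x"
proof -
  have mult: "e i p q * e j r s = (if i = j \<and> q = r then e i p s else 0)"
    if "p < d i" "q < d i" "r < d j" "s < d j" for i p q j r s
    using that e unfolding matrix_units_def by blast
  have "e j p p * x * e j q q
      = (\<Sum>j'\<in>UNIV. \<Sum>p'<d j'. \<Sum>q'<d j'. cscale (c j' p' q') (e j p p * e j' p' q' * e j q q))"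
    unfolding x sum_distrib_left sum_distrib_right cscale_mult_left cscale_mult_right ..
  also have "\<dots> = (\<Sum>j'\<in>UNIV. \<Sum>p'<d j'. \<Sum>q'<d j'.
      if j' = j \<and> p' = p \<and> q' = q then cscale (c j' p' q') (e j' p' q') else 0)"
    using pq by (intro sum.cong refl) (auto simp: mult)
  also have "\<dots> = cscale (c j p q) (e j p q)" by (rule sum_units_delta[of p d j q, OF pq])
  finally have "norm (cscale (c j p q) (e j p q)) \<le> norm (e j p p) * norm x * norm (e j q q)"
    using order_trans[OF norm_mult_ineq mult_right_mono[OF norm_mult_ineq norm_ge_zero],
        of "e j p p" x "e j q q"] by simp
  then show ?thesis using norm_matrix_unit[OF e] pq by (simp add: norm_cscale)
qed

lemma unit_graph_norm_le:
  assumes e: "matrix_units d e" and g: "matrix_units d g" and xy: "(x, y) \<in> unit_graph d e g"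
  shows "norm y \<le> norm x"
proof -
  \<comment> \<open>Bounding every coefficient gives a crude constant, the number of units;
    \<open>bounded_star_hom_contractive\<close> then improves it to 1.\<close>
  have "norm y \<le> (\<Sum>j\<in>UNIV. \<Sum>p<d j. \<Sum>q<d j. 1) * norm x" if "(x, y) \<in> unit_graph d e g" for x y
  proof -
    obtain c where c: "x = (\<Sum>j\<in>UNIV. \<Sum>p<d j. \<Sum>q<d j. cscale (c j p q) (e j p q))"
      "y = (\<Sum>j\<in>UNIV. \<Sum>p<d j. \<Sum>q<d j. cscale (c j p q) (g j p q))" using \<open>(x, y) \<in> _\<close> by (rule unit_graph_E)
    have "norm y \<le> (\<Sum>j\<in>UNIV. \<Sum>p<d j. \<Sum>q<d j. norm x)"
      unfolding c(2)
    proof (intro sum_norm_le)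
      fix j p q assume "p \<in> {..<d j}" "q \<in> {..<d j}"
      then show "norm (cscale (c j p q) (g j p q)) \<le> norm x"
        using norm_matrix_unit[OF g, of p j q] norm_coefficient_le[OF e _ _ c(1), of p j q]
        by (simp add: norm_cscale)
    qed
    then show ?thesis by (simp add: sum_distrib_right mult.assoc)
  qed
  then show ?thesis
    using bounded_star_hom_contractive[of "unit_graph d e g", OF unit_graph_mult unit_graph_adj] e g xy
    by blast
qed

lemma unit_graph_converse: "(x, y) \<in> unit_graph d e g \<longleftrightarrow> (y, x) \<in> unit_graph d g e"
  unfolding unit_graph_def by blast

lemma unit_graph_norm_eq:
  assumes "matrix_units d e" "matrix_units d g" "(x, y) \<in> unit_graph d e g"
  shows "norm x = norm y"
  using unit_graph_norm_le assms unit_graph_converse by (metis order_antisym)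

lemma cstar_isomorphic_of_matched_units:
  fixes e :: "nat \<Rightarrow> 'n::finite \<Rightarrow> nat \<Rightarrow> nat \<Rightarrow> 'a::cstar_algebra"
    and g :: "nat \<Rightarrow> 'n::finite \<Rightarrow> nat \<Rightarrow> nat \<Rightarrow> 'b::cstar_algebra"
  assumes e: "\<And>k. matrix_units (d k) (e k)" and g: "\<And>k. matrix_units (d k) (g k)"
    and step: "\<And>k. unit_graph (d k) (e k) (g k) \<subseteq> unit_graph (d (Suc k)) (e (Suc k)) (g (Suc k))"
    and dense_e: "closure (\<Union>k. matrix_algebra (d k) (e k)) = UNIV"
    and dense_g: "closure (\<Union>k. matrix_algebra (d k) (g k)) = UNIV"
  shows "cstar_isomorphic TYPE('a) TYPE('b)"
proof (rule cstar_isomorphic_of_dense_graph)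
  define G where "G k = unit_graph (d k) (e k) (g k)" for k
  let ?R = "\<Union>k. G k"
  have mono: "G k \<subseteq> G k'" if "k \<le> k'" for k k'
    using lift_Suc_mono_le[of G] step that unfolding G_def by blast
  \<comment> \<open>The levels increase, so any two elements lie in a common level, where the
    operations are already compatible.\<close>
  have common: "\<exists>k. z \<in> G k \<and> z' \<in> G k" if "z \<in> ?R" "z' \<in> ?R" for z z'
  proof -
    obtain k k' where "z \<in> G k" "z' \<in> G k'" using \<open>z \<in> ?R\<close> \<open>z' \<in> ?R\<close> by blast
    then show ?thesis
      using mono[OF max.cobounded1, of k k'] mono[OF max.cobounded2, of k' k] by blast
  qed
  show "(x + x', y + y') \<in> ?R" if "(x, y) \<in> ?R" "(x', y') \<in> ?R" for x y x' y'
    using common[OF that] by (auto simp: G_def intro: unit_graph_add)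
  show "(x * x', y * y') \<in> ?R" if "(x, y) \<in> ?R" "(x', y') \<in> ?R" for x y x' y'
    using common[OF that] by (auto simp: G_def intro: unit_graph_mult e g)
  show "(cscale c x, cscale c y) \<in> ?R" if "(x, y) \<in> ?R" for c x y
    using that by (auto simp: G_def intro: unit_graph_cscale)
  show "(adj x, adj y) \<in> ?R" if "(x, y) \<in> ?R" for x y
    using that by (auto simp: G_def intro: unit_graph_adj e g)
  show "norm x = norm y" if "(x, y) \<in> ?R" for x y
    using that by (auto simp: G_def intro: unit_graph_norm_eq e g)
  show "closure (fst ` ?R) = UNIV" "closure (snd ` ?R) = UNIV"
    using dense_e dense_g unfolding G_def image_UN fst_unit_graph snd_unit_graph by auto
qed

section \<open>Block diagonal embeddings\<close>

text \<open>
  The multiplicities are given by finite sets instead of numbers, so that the composition of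
  embeddings needs no numbering.
\<close>

definition block_rows :: "('n \<Rightarrow> 'x set) \<Rightarrow> ('n \<Rightarrow> nat) \<Rightarrow> ('n \<times> 'x \<times> nat) set" where
  "block_rows M d = {(j, r, p). r \<in> M j \<and> p < d j}"

text \<open>Unlike in \<open>incidence\<close>, the row numbering is a parameter, so that two
  embeddings can be required to share it; this makes them compatible with
  \<open>unit_graph\<close>.\<close>

definition block_embedding ::
  "('m \<Rightarrow> 'n \<Rightarrow> 'x set) \<Rightarrow> ('m \<Rightarrow> 'n \<times> 'x \<times> nat \<Rightarrow> nat)
    \<Rightarrow> ('n::finite \<Rightarrow> nat) \<Rightarrow> ('n \<Rightarrow> nat \<Rightarrow> nat \<Rightarrow> 'a::cstar_algebra)
    \<Rightarrow> ('m::finite \<Rightarrow> nat) \<Rightarrow> ('m \<Rightarrow> nat \<Rightarrow> nat \<Rightarrow> 'a) \<Rightarrow> bool" where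
  "block_embedding M \<sigma> d e d' e' \<longleftrightarrow>
     (\<forall>i. bij_betw (\<sigma> i) (block_rows (M i) d) {..<d' i}) \<and>
     (\<forall>j. \<forall>p<d j. \<forall>q<d j. e j p q = (\<Sum>i\<in>UNIV. \<Sum>r\<in>M i j. e' i (\<sigma> i (j, r, p)) (\<sigma> i (j, r, q))))"

lemma incidence_iff_block_embedding:
  "incidence J d e d' e' \<longleftrightarrow> (\<exists>\<sigma>. block_embedding (\<lambda>i j. {..<nat (J $ i $ j)}) \<sigma> d e d' e')"
  unfolding incidence_def block_embedding_def block_rows_def by simp

lemma block_embedding_range:
  assumes "block_embedding M \<sigma> d e d' e'" "r \<in> M i j" "p < d j"
  shows "\<sigma> i (j, r, p) < d' i"
proof -
  have "(j, r, p) \<in> block_rows (M i) d" using assms(2,3) by (simp add: block_rows_def)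
  then have "\<sigma> i (j, r, p) \<in> {..<d' i}"
    using assms(1) unfolding block_embedding_def bij_betw_def by blast
  then show ?thesis by simp
qed

lemma block_embedding_unit_graph:
  assumes e: "block_embedding M \<sigma> d e d' e'" and g: "block_embedding M \<sigma> d g d' g'"
  shows "unit_graph d e g \<subseteq> unit_graph d' e' g'"
proof (rule unit_graph_subset)
  fix j p q assume pq: "p < d j" "q < d j"
  have "e j p q = (\<Sum>i\<in>UNIV. \<Sum>r\<in>M i j. e' i (\<sigma> i (j, r, p)) (\<sigma> i (j, r, q)))"
    "g j p q = (\<Sum>i\<in>UNIV. \<Sum>r\<in>M i j. g' i (\<sigma> i (j, r, p)) (\<sigma> i (j, r, q)))"
    using e g pq unfolding block_embedding_def by blast+
  then show "(e j p q, g j p q) \<in> unit_graph d' e' g'"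
    using block_embedding_range[OF e] pq by (auto intro!: unit_graph_sum unit_graph_unit)
qed

lemma block_embedding_matrix_algebra:
  assumes "block_embedding M \<sigma> d e d' e'"
  shows "matrix_algebra d e \<subseteq> matrix_algebra d' e'"
  using image_mono[OF block_embedding_unit_graph[OF assms assms], of fst] by (simp add: fst_unit_graph)

text \<open>Renaming copies along bijections permutes the terms of each sum. It translates between
  copies labelled by numbers and copies labelled by the triples of \<open>mult_comp\<close>.\<close>

lemma block_embedding_reindex:
  assumes e: "block_embedding M \<sigma> d e d' e'" and \<beta>: "\<And>i j. bij_betw (\<beta> i j) (M' i j) (M i j)"
  shows "block_embedding M' (\<lambda>i (j, r, p). \<sigma> i (j, \<beta> i j r, p)) d e d' e'"
proof -
  have "bij_betw (\<lambda>(j, r, p). (j, \<beta> i j r, p)) (block_rows (M' i) d) (block_rows (M i) d)" for i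
  proof (rule bij_betw_byWitness[where f' = "\<lambda>(j, r, p). (j, inv_into (M' i j) (\<beta> i j) r, p)"])
    show "\<forall>a\<in>block_rows (M' i) d. (\<lambda>(j, r, p). (j, inv_into (M' i j) (\<beta> i j) r, p)) ((\<lambda>(j, r, p). (j, \<beta> i j r, p)) a) = a"
      using bij_betw_inv_into_left[OF \<beta>] by (auto simp: block_rows_def)
    show "\<forall>a\<in>block_rows (M i) d. (\<lambda>(j, r, p). (j, \<beta> i j r, p)) ((\<lambda>(j, r, p). (j, inv_into (M' i j) (\<beta> i j) r, p)) a) = a"
      using bij_betw_inv_into_right[OF \<beta>] by (auto simp: block_rows_def)
    show "(\<lambda>(j, r, p). (j, \<beta> i j r, p)) ` block_rows (M' i) d \<subseteq> block_rows (M i) d"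
      using bij_betwE[OF \<beta>] by (auto simp: block_rows_def)
    show "(\<lambda>(j, r, p). (j, inv_into (M' i j) (\<beta> i j) r, p)) ` block_rows (M i) d \<subseteq> block_rows (M' i) d"
      using bij_betwE[OF bij_betw_inv_into[OF \<beta>]] by (auto simp: block_rows_def)
  qed
  then have "bij_betw (\<sigma> i \<circ> (\<lambda>(j, r, p). (j, \<beta> i j r, p))) (block_rows (M' i) d) {..<d' i}" for i
    using e unfolding block_embedding_def by (blast intro: bij_betw_trans)
  moreover have "\<sigma> i \<circ> (\<lambda>(j, r, p). (j, \<beta> i j r, p)) = (\<lambda>(j, r, p). \<sigma> i (j, \<beta> i j r, p))" for i
    by auto
  moreover have "(\<Sum>r\<in>M i j. e' i (\<sigma> i (j, r, p)) (\<sigma> i (j, r, q)))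
      = (\<Sum>r\<in>M' i j. e' i (\<sigma> i (j, \<beta> i j r, p)) (\<sigma> i (j, \<beta> i j r, q)))" for i j p q
    by (rule sum.reindex_bij_betw[OF \<beta>, symmetric])
  ultimately show ?thesis using e unfolding block_embedding_def by simp
qed

text \<open>These triples are the paths of length two from \<open>j\<close> to \<open>m\<close> in
  the Bratteli diagram, so finite label sets are counted by the product of the multiplicity
  matrices.\<close>

definition mult_comp :: "('l \<Rightarrow> 'm \<Rightarrow> 'y set) \<Rightarrow> ('m \<Rightarrow> 'n \<Rightarrow> 'x set) \<Rightarrow> 'l \<Rightarrow> 'n \<Rightarrow> ('m \<times> 'y \<times> 'x) set" where
  "mult_comp M' M m j = {(i, s, r). s \<in> M' m i \<and> r \<in> M i j}"

text \<open>The inner row \<open>(j, r, p)\<close> is replaced by its number in the intermediate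
  block \<open>i\<close>; decoding that number gives the inverse.\<close>

lemma bij_betw_block_rows_comp:
  assumes \<sigma>: "\<And>i. bij_betw (\<sigma> i) (block_rows (M i) d) {..<d' i}"
  shows "bij_betw (\<lambda>(j, (i, s, r), p). (i, s, \<sigma> i (j, r, p)))
    (block_rows (mult_comp M' M m) d) (block_rows (M' m) d')"
proof (rule bij_betw_byWitness[where f' = "\<lambda>(i, s, x). case inv_into (block_rows (M i) d) (\<sigma> i) x of
    (j, r, p) \<Rightarrow> (j, (i, s, r), p)"])
  let ?f = "\<lambda>(j, (i, s, r), p). (i, s, \<sigma> i (j, r, p))"
  let ?f' = "\<lambda>(i, s, x). case inv_into (block_rows (M i) d) (\<sigma> i) x of (j, r, p) \<Rightarrow> (j, (i, s, r), p)"
  have inv: "inv_into (block_rows (M i) d) (\<sigma> i) (\<sigma> i (j, r, p)) = (j, r, p)"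
    if "r \<in> M i j" "p < d j" for i j r p
    using that by (intro bij_betw_inv_into_left[OF \<sigma>]) (simp add: block_rows_def)
  have range: "\<sigma> i (j, r, p) < d' i" if "r \<in> M i j" "p < d j" for i j r p
    using that bij_betwE[OF \<sigma>, of i] by (auto simp: block_rows_def)
  have surj: "\<exists>j r p. r \<in> M i j \<and> p < d j \<and> x = \<sigma> i (j, r, p)" if "x < d' i" for i x
    using that bij_betw_imp_surj_on[OF \<sigma>, of i] by (auto simp: block_rows_def image_iff set_eq_iff)
  show "\<forall>a\<in>block_rows (mult_comp M' M m) d. ?f' (?f a) = a"
    by (auto simp: block_rows_def mult_comp_def inv[unfolded block_rows_def])
  show "\<forall>a\<in>block_rows (M' m) d'. ?f (?f' a) = a"
    by (auto simp: block_rows_def inv[unfolded block_rows_def] dest!: surj)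
  show "?f ` block_rows (mult_comp M' M m) d \<subseteq> block_rows (M' m) d'"
    by (auto simp: block_rows_def mult_comp_def range)
  show "?f' ` block_rows (M' m) d' \<subseteq> block_rows (mult_comp M' M m) d"
    by (auto simp: block_rows_def mult_comp_def inv[unfolded block_rows_def] dest!: surj)
qed

lemma sum_mult_comp:
  fixes M' :: "'l::finite \<Rightarrow> 'm::finite \<Rightarrow> 'y set"
  assumes "\<And>m i. finite (M' m i)" "\<And>i j. finite (M i j)"
  shows "(\<Sum>m\<in>UNIV. \<Sum>(i, s, r)\<in>mult_comp M' M m j. F m i s r)
    = (\<Sum>i\<in>UNIV. \<Sum>r\<in>M i j. \<Sum>m\<in>UNIV. \<Sum>s\<in>M' m i. (F m i s r :: 'a::comm_monoid_add))"
proof -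
  have "mult_comp M' M m j = (SIGMA i:UNIV. M' m i \<times> M i j)" for m
    by (auto simp: mult_comp_def)
  then have "(\<Sum>m\<in>UNIV. \<Sum>(i, s, r)\<in>mult_comp M' M m j. F m i s r)
      = (\<Sum>m\<in>UNIV. \<Sum>i\<in>UNIV. \<Sum>s\<in>M' m i. \<Sum>r\<in>M i j. F m i s r)"
    using assms by (simp add: sum.Sigma[symmetric] sum.cartesian_product[symmetric])
  also have "\<dots> = (\<Sum>i\<in>UNIV. \<Sum>m\<in>UNIV. \<Sum>s\<in>M' m i. \<Sum>r\<in>M i j. F m i s r)"
    by (rule sum.swap)
  also have "\<dots> = (\<Sum>i\<in>UNIV. \<Sum>r\<in>M i j. \<Sum>m\<in>UNIV. \<Sum>s\<in>M' m i. F m i s r)"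
    by (simp add: sum.swap[of _ "M _ j"])
  finally show ?thesis .
qed

lemma block_embedding_trans:
  assumes fin: "\<And>m i. finite (M' m i)" "\<And>i j. finite (M i j)"
    and e: "block_embedding M \<sigma> d e d' e'" and e': "block_embedding M' \<sigma>' d' e' d'' e''"
  shows "block_embedding (mult_comp M' M) (\<lambda>m (j, (i, s, r), p). \<sigma>' m (i, s, \<sigma> i (j, r, p))) d e d'' e''"
proof -
  have "bij_betw (\<sigma>' m \<circ> (\<lambda>(j, (i, s, r), p). (i, s, \<sigma> i (j, r, p)))) (block_rows (mult_comp M' M m) d) {..<d'' m}" for m
    by (rule bij_betw_trans[OF bij_betw_block_rows_comp]) (use e e' in \<open>auto simp: block_embedding_def\<close>)
  moreover have "\<sigma>' m \<circ> (\<lambda>(j, (i, s, r), p). (i, s, \<sigma> i (j, r, p)))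
      = (\<lambda>(j, (i, s, r), p). \<sigma>' m (i, s, \<sigma> i (j, r, p)))" for m by auto
  moreover have "e j p q = (\<Sum>m\<in>UNIV. \<Sum>(i, s, r)\<in>mult_comp M' M m j.
      e'' m (\<sigma>' m (i, s, \<sigma> i (j, r, p))) (\<sigma>' m (i, s, \<sigma> i (j, r, q))))"
    if pq: "p < d j" "q < d j" for j p q
  proof -
    have "e j p q = (\<Sum>i\<in>UNIV. \<Sum>r\<in>M i j. e' i (\<sigma> i (j, r, p)) (\<sigma> i (j, r, q)))"
      using e pq unfolding block_embedding_def by blast
    also have "\<dots> = (\<Sum>i\<in>UNIV. \<Sum>r\<in>M i j. \<Sum>m\<in>UNIV. \<Sum>s\<in>M' m i.
        e'' m (\<sigma>' m (i, s, \<sigma> i (j, r, p))) (\<sigma>' m (i, s, \<sigma> i (j, r, q))))"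
      using e' block_embedding_range[OF e] pq by (intro sum.cong refl) (simp add: block_embedding_def)
    finally show ?thesis by (simp add: sum_mult_comp[OF fin])
  qed
  ultimately show ?thesis unfolding block_embedding_def by (simp add: case_prod_unfold)
qed

text \<open>These are the units of an intermediate algebra, built inside the span of
  \<open>e''\<close>: each is the sum of its copies in the blocks \<open>m\<close>. Every
  \<open>i\<close> must occur in some block, otherwise its units would be the empty sum 0.\<close>

lemma matrix_units_of_block_sums:
  assumes e'': "matrix_units d'' e''"
    and fin: "\<And>m i. finite (M' m i)"
    and \<sigma>: "\<And>m. bij_betw (\<sigma> m) (block_rows (M' m) d') {..<d'' m}"
    and nonempty: "\<And>i. \<exists>m. M' m i \<noteq> {}"
  shows "matrix_units d' (\<lambda>i x y. \<Sum>m\<in>UNIV. \<Sum>s\<in>M' m i. e'' m (\<sigma> m (i, s, x)) (\<sigma> m (i, s, y)))"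
    (is "matrix_units d' ?e")
proof -
  have range: "\<sigma> m (i, s, x) < d'' m" if "s \<in> M' m i" "x < d' i" for m i s x
    using that bij_betwE[OF \<sigma>, of m] by (auto simp: block_rows_def)
  have inj: "\<sigma> m (i, s, x) = \<sigma> m (i', s', x') \<longleftrightarrow> i = i' \<and> s = s' \<and> x = x'"
    if "s \<in> M' m i" "x < d' i" "s' \<in> M' m i'" "x' < d' i'" for m i s x i' s' x'
    using that inj_onD[OF bij_betw_imp_inj_on[OF \<sigma>], of m "(i, s, x)" "(i', s', x')"]
    by (auto simp: block_rows_def)
  have mult: "e'' i p q * e'' j r s = (if i = j \<and> q = r then e'' i p s else 0)"
    if "p < d'' i" "q < d'' i" "r < d'' j" "s < d'' j" for i p q j r s
    using that e'' unfolding matrix_units_def by blast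
  have "?e i p q * ?e j r s = (if i = j \<and> q = r then ?e i p s else 0)"
    if pqrs: "p < d' i" "q < d' i" "r < d' j" "s < d' j" for i p q j r s
  proof -
    have "?e i p q * ?e j r s = (\<Sum>m\<in>UNIV. \<Sum>a\<in>M' m i. \<Sum>m'\<in>UNIV. \<Sum>b\<in>M' m' j.
        e'' m (\<sigma> m (i, a, p)) (\<sigma> m (i, a, q)) * e'' m' (\<sigma> m' (j, b, r)) (\<sigma> m' (j, b, s)))"
      unfolding sum_distrib_right by (simp only: sum_distrib_left)
    \<comment> \<open>Units of different blocks annihilate each other, and injectivity of
      \<open>\<sigma> m\<close> turns equal row numbers into \<open>i = j\<close>,
      \<open>a = b\<close> and \<open>q = r\<close>.\<close>
    also have "\<dots> = (\<Sum>m\<in>UNIV. \<Sum>a\<in>M' m i. \<Sum>m'\<in>UNIV. \<Sum>b\<in>M' m' j.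
        if m' = m then if i = j \<and> a = b \<and> q = r then e'' m (\<sigma> m (i, a, p)) (\<sigma> m (i, a, s)) else 0 else 0)"
      using pqrs by (intro sum.cong refl) (auto simp: mult range inj)
    also have "\<dots> = (\<Sum>m\<in>UNIV. \<Sum>a\<in>M' m i. \<Sum>m'\<in>UNIV. if m' = m then
        (\<Sum>b\<in>M' m' j. if a = b then if i = j \<and> q = r then e'' m (\<sigma> m (i, a, p)) (\<sigma> m (i, a, s)) else 0 else 0) else 0)"
      by (intro sum.cong refl) (auto intro!: sum.cong)
    also have "\<dots> = (if i = j \<and> q = r then ?e i p s else 0)"
      using fin by (auto simp: sum.delta' intro!: sum.neutral)
    finally show ?thesis .
  qed
  moreover have "adj (?e i p q) = ?e i q p" if "p < d' i" "q < d' i" for i p q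
    unfolding adj_sum using that e'' range by (intro sum.cong refl) (simp add: matrix_units_def)
  moreover have "?e i p p \<noteq> 0" if p: "p < d' i" for i p
  proof -
    obtain m a where a: "a \<in> M' m i" using nonempty by blast
    let ?x = "\<sigma> m (i, a, p)"
    \<comment> \<open>Multiplying by one diagonal unit that occurs in the sum leaves just that unit,
      so the sum is nonzero.\<close>
    have "?e i p p * e'' m ?x ?x = (\<Sum>m'\<in>UNIV. \<Sum>b\<in>M' m' i. if m' = m then if b = a then e'' m ?x ?x else 0 else 0)"
      unfolding sum_distrib_right using p a by (intro sum.cong refl) (auto simp: mult range inj)
    also have "\<dots> = (\<Sum>m'\<in>UNIV. if m' = m then (\<Sum>b\<in>M' m' i. if b = a then e'' m ?x ?x else 0) else 0)"
      by (intro sum.cong refl) auto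
    also have "\<dots> = e'' m ?x ?x" using fin a by simp
    also have "\<dots> \<noteq> 0" using e'' range[OF a p] unfolding matrix_units_def by blast
    finally show ?thesis by auto
  qed
  moreover have "(\<Sum>i\<in>UNIV. \<Sum>p<d' i. ?e i p p) = 1"
  proof -
    have "(\<Sum>i\<in>UNIV. \<Sum>p<d' i. ?e i p p)
        = (\<Sum>m\<in>UNIV. \<Sum>i\<in>UNIV. \<Sum>p<d' i. \<Sum>s\<in>M' m i. e'' m (\<sigma> m (i, s, p)) (\<sigma> m (i, s, p)))"
      by (simp add: sum.swap[of _ UNIV "{..<_}"]) (rule sum.swap)
    also have "\<dots> = (\<Sum>m\<in>UNIV. \<Sum>i\<in>UNIV. \<Sum>s\<in>M' m i. \<Sum>p<d' i. e'' m (\<sigma> m (i, s, p)) (\<sigma> m (i, s, p)))"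
      by (simp add: sum.swap[of _ "{..<_}"])
    also have "\<dots> = (\<Sum>m\<in>UNIV. \<Sum>x\<in>block_rows (M' m) d'. e'' m (\<sigma> m x) (\<sigma> m x))"
    proof (intro sum.cong refl)
      fix m
      have rows: "block_rows (M' m) d' = (SIGMA i:UNIV. M' m i \<times> {..<d' i})" by (auto simp: block_rows_def)
      show "(\<Sum>i\<in>UNIV. \<Sum>s\<in>M' m i. \<Sum>p<d' i. e'' m (\<sigma> m (i, s, p)) (\<sigma> m (i, s, p)))
          = (\<Sum>x\<in>block_rows (M' m) d'. e'' m (\<sigma> m x) (\<sigma> m x))"
        unfolding rows using fin by (simp add: sum.Sigma sum.cartesian_product case_prod_unfold)
    qed
    also have "\<dots> = (\<Sum>m\<in>UNIV. \<Sum>x<d'' m. e'' m x x)"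
      by (intro sum.cong refl sum.reindex_bij_betw[OF \<sigma>])
    also have "\<dots> = 1" using e'' unfolding matrix_units_def by blast
    finally show ?thesis .
  qed
  ultimately show ?thesis unfolding matrix_units_def by blast
qed

text \<open>The intermediate rows can be numbered arbitrarily by \<open>\<sigma>\<close>; the given
  numbering \<open>\<tau>\<close> of the composite then forces \<open>\<sigma>'\<close>. The wanted
  units are the block sums of \<open>e''\<close> along \<open>\<sigma>'\<close>.\<close>

lemma block_embedding_factor:
  fixes M' :: "'l::finite \<Rightarrow> 'm::finite \<Rightarrow> 'y set" and M :: "'m \<Rightarrow> 'n::finite \<Rightarrow> 'x set"
  assumes fin: "\<And>m i. finite (M' m i)" "\<And>i j. finite (M i j)"
    and e: "block_embedding (mult_comp M' M) \<tau> d e d'' e''"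
    and e'': "matrix_units d'' e''"
    and d': "\<And>i. card (block_rows (M i) d) = d' i"
    and nonempty: "\<And>i. \<exists>m. M' m i \<noteq> {}"
  shows "\<exists>\<sigma> \<sigma>' e'. matrix_units d' e' \<and> block_embedding M \<sigma> d e d' e' \<and> block_embedding M' \<sigma>' d' e' d'' e''"
proof -
  have "block_rows (M i) d = (SIGMA j:UNIV. M i j \<times> {..<d j})" for i by (auto simp: block_rows_def)
  then have "finite (block_rows (M i) d)" for i using fin(2) by simp
  then have "\<forall>i. \<exists>f. bij_betw f (block_rows (M i) d) {..<d' i}"
    using ex_bij_betw_finite_nat[of "block_rows (M _) d"] d' by (metis atLeast0LessThan)
  then obtain \<sigma> where \<sigma>: "\<And>i. bij_betw (\<sigma> i) (block_rows (M i) d) {..<d' i}" by metis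
  let ?f = "\<lambda>(j, (i, s, r), p). (i, s, \<sigma> i (j, r, p))"
  \<comment> \<open>\<open>?f\<close> encodes composite rows as rows of the outer embedding; undoing
    it and applying \<open>\<tau>\<close> gives \<open>\<sigma>' m (i, s, \<sigma> i (j, r, p)) =
    \<tau> m (j, (i, s, r), p)\<close>.\<close>
  define \<sigma>' where "\<sigma>' m = \<tau> m \<circ> inv_into (block_rows (mult_comp M' M m) d) ?f" for m
  have \<tau>: "\<And>m. bij_betw (\<tau> m) (block_rows (mult_comp M' M m) d) {..<d'' m}"
    using e unfolding block_embedding_def by blast
  have \<sigma>': "bij_betw (\<sigma>' m) (block_rows (M' m) d') {..<d'' m}" for m
    unfolding \<sigma>'_def by (rule bij_betw_trans[OF bij_betw_inv_into[OF bij_betw_block_rows_comp[OF \<sigma>]] \<tau>])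
  have \<sigma>'_eq: "\<sigma>' m (i, s, \<sigma> i (j, r, p)) = \<tau> m (j, (i, s, r), p)"
    if "s \<in> M' m i" "r \<in> M i j" "p < d j" for m i s j r p
  proof -
    have "inv_into (block_rows (mult_comp M' M m) d) ?f (?f (j, (i, s, r), p)) = (j, (i, s, r), p)"
      by (rule bij_betw_inv_into_left[OF bij_betw_block_rows_comp[OF \<sigma>]])
        (use that in \<open>simp add: block_rows_def mult_comp_def\<close>)
    then show ?thesis by (simp add: \<sigma>'_def)
  qed
  define e' where "e' i x y = (\<Sum>m\<in>UNIV. \<Sum>s\<in>M' m i. e'' m (\<sigma>' m (i, s, x)) (\<sigma>' m (i, s, y)))" for i x y
  have "matrix_units d' e'"
    unfolding e'_def[abs_def] by (rule matrix_units_of_block_sums[OF e'' fin(1) \<sigma>' nonempty])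
  moreover have "block_embedding M' \<sigma>' d' e' d'' e''"
    unfolding block_embedding_def using \<sigma>' e'_def by blast
  moreover have "block_embedding M \<sigma> d e d' e'"
    unfolding block_embedding_def
  proof (intro conjI allI impI \<sigma>)
    fix j p q assume pq: "p < d j" "q < d j"
    have "e j p q = (\<Sum>m\<in>UNIV. \<Sum>(i, s, r)\<in>mult_comp M' M m j.
        e'' m (\<tau> m (j, (i, s, r), p)) (\<tau> m (j, (i, s, r), q)))"
      using e pq unfolding block_embedding_def by (simp add: case_prod_unfold)
    also have "\<dots> = (\<Sum>i\<in>UNIV. \<Sum>r\<in>M i j. \<Sum>m\<in>UNIV. \<Sum>s\<in>M' m i.
        e'' m (\<tau> m (j, (i, s, r), p)) (\<tau> m (j, (i, s, r), q)))"
      by (rule sum_mult_comp[OF fin])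
    also have "\<dots> = (\<Sum>i\<in>UNIV. \<Sum>r\<in>M i j. e' i (\<sigma> i (j, r, p)) (\<sigma> i (j, r, q)))"
      unfolding e'_def using pq by (intro sum.cong refl) (simp add: \<sigma>'_eq)
    finally show "e j p q = (\<Sum>i\<in>UNIV. \<Sum>r\<in>M i j. e' i (\<sigma> i (j, r, p)) (\<sigma> i (j, r, q)))" .
  qed
  ultimately show ?thesis by blast
qed

section \<open>Diagrams and intertwinings\<close>

definition nonneg_mat :: "int^'n^'m \<Rightarrow> bool" where
  "nonneg_mat J \<longleftrightarrow> (\<forall>i j. 0 \<le> J $ i $ j)"

text \<open>The paths through \<open>i\<close> number \<open>J' $ m $ i * J $ i $ j\<close>, and
  nonnegativity ensures that \<open>nat\<close> loses nothing, so both sets have the same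
  size.\<close>

lemma ex_bij_mult_comp:
  fixes J :: "int^'n::finite^'n" and J' :: "int^'n^'n"
  assumes "nonneg_mat J" "nonneg_mat J'"
  shows "\<exists>\<beta>. bij_betw \<beta> {..<nat ((J' ** J) $ m $ j)}
    (mult_comp (\<lambda>m i. {..<nat (J' $ m $ i)}) (\<lambda>i j. {..<nat (J $ i $ j)}) m j)"
proof -
  have eq: "mult_comp (\<lambda>m i. {..<nat (J' $ m $ i)}) (\<lambda>i j. {..<nat (J $ i $ j)}) m j
      = (SIGMA i:UNIV. {..<nat (J' $ m $ i)} \<times> {..<nat (J $ i $ j)})"
    by (auto simp: mult_comp_def)
  have "int (card (SIGMA i:(UNIV::'n set). {..<nat (J' $ m $ i)} \<times> {..<nat (J $ i $ j)})) = (J' ** J) $ m $ j"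
    using assms by (simp add: matrix_matrix_mult_def nonneg_mat_def)
  from arg_cong[OF this, of nat]
  have "card {..<nat ((J' ** J) $ m $ j)} = card (SIGMA i:(UNIV::'n set). {..<nat (J' $ m $ i)} \<times> {..<nat (J $ i $ j)})"
    by (simp only: nat_int card_lessThan)
  then show ?thesis unfolding eq by (intro finite_same_card_bij) auto
qed

lemma incidence_mult:
  fixes J :: "int^'n::finite^'n" and J' :: "int^'n^'n"
  assumes nonneg: "nonneg_mat J" "nonneg_mat J'"
    and inc: "incidence J d e d' e'" "incidence J' d' e' d'' e''"
  shows "incidence (J' ** J) d e d'' e''"
proof -
  obtain \<sigma> \<sigma>' where "block_embedding (\<lambda>i j. {..<nat (J $ i $ j)}) \<sigma> d e d' e'"
    "block_embedding (\<lambda>i j. {..<nat (J' $ i $ j)}) \<sigma>' d' e' d'' e''"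
    using inc unfolding incidence_iff_block_embedding by blast
  from block_embedding_trans[OF _ _ this]
  have "block_embedding (mult_comp (\<lambda>m i. {..<nat (J' $ m $ i)}) (\<lambda>i j. {..<nat (J $ i $ j)}))
      (\<lambda>m (j, (i, s, r), p). \<sigma>' m (i, s, \<sigma> i (j, r, p))) d e d'' e''" by simp
  moreover obtain \<beta> where "\<And>m j. bij_betw (\<beta> m j) {..<nat ((J' ** J) $ m $ j)}
    (mult_comp (\<lambda>m i. {..<nat (J' $ m $ i)}) (\<lambda>i j. {..<nat (J $ i $ j)}) m j)"
    using ex_bij_mult_comp[OF nonneg] by metis
  ultimately show ?thesis
    unfolding incidence_iff_block_embedding by (intro exI) (rule block_embedding_reindex)
qed

text \<open>Matrix version of \<open>block_embedding_factor\<close>. The sizes \<open>d'\<close> are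
  those that \<open>J\<close> prescribes, and a positive entry in each column of \<open>J'\<close>
  keeps every intermediate unit nonzero.\<close>

lemma incidence_factor:
  fixes J :: "int^'n::finite^'n" and J' :: "int^'n^'n"
  assumes nonneg: "nonneg_mat J" "nonneg_mat J'"
    and inc: "incidence (J' ** J) d e d'' e''" and e'': "matrix_units d'' e''"
    and d': "\<And>i. int (d' i) = (\<Sum>j\<in>UNIV. J $ i $ j * int (d j))"
    and nonzero: "\<And>i. \<exists>m. J' $ m $ i > 0"
  shows "\<exists>e'. matrix_units d' e' \<and> incidence J d e d' e' \<and> incidence J' d' e' d'' e''"
proof -
  let ?MM = "mult_comp (\<lambda>m i. {..<nat (J' $ m $ i)}) (\<lambda>i j. {..<nat (J $ i $ j)})"
  obtain \<tau> where \<tau>: "block_embedding (\<lambda>i j. {..<nat ((J' ** J) $ i $ j)}) \<tau> d e d'' e''"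
    using inc unfolding incidence_iff_block_embedding by blast
  obtain \<beta> where "\<And>m j. bij_betw (\<beta> m j) {..<nat ((J' ** J) $ m $ j)} (?MM m j)"
    using ex_bij_mult_comp[OF nonneg] by metis
  then have \<tau>': "block_embedding ?MM
      (\<lambda>i (j, r, p). \<tau> i (j, inv_into {..<nat ((J' ** J) $ i $ j)} (\<beta> i j) r, p)) d e d'' e''"
    by (intro block_embedding_reindex[OF \<tau>, where \<beta> = "\<lambda>i j. inv_into {..<nat ((J' ** J) $ i $ j)} (\<beta> i j)"]
        bij_betw_inv_into)
  have "int (card (block_rows (\<lambda>j. {..<nat (J $ i $ j)}) d)) = int (d' i)" for i
  proof -
    have "block_rows (\<lambda>j. {..<nat (J $ i $ j)}) d = (SIGMA j:UNIV. {..<nat (J $ i $ j)} \<times> {..<d j})"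
      by (auto simp: block_rows_def)
    then show ?thesis using nonneg by (simp add: d' nonneg_mat_def)
  qed
  then have card: "card (block_rows (\<lambda>j. {..<nat (J $ i $ j)}) d) = d' i" for i by simp
  have ne: "\<exists>m. {..<nat (J' $ m $ i)} \<noteq> {}" for i
  proof -
    obtain m where "J' $ m $ i > 0" using nonzero by blast
    then have "0 \<in> {..<nat (J' $ m $ i)}" by simp
    then show ?thesis by blast
  qed
  show ?thesis
    unfolding incidence_iff_block_embedding
    using block_embedding_factor[OF _ _ \<tau>' e'' card ne] by blast
qed

lemma incidence_refl: "incidence (mat 1) d e d e"
  unfolding incidence_def
proof (intro exI[of _ "\<lambda>i (j, r, p). p"] conjI allI impI)
  have *: "{(j, r, p). r < nat (mat 1 $ i $ j :: int) \<and> p < d j} = (\<lambda>p. (i, 0, p)) ` {..<d i}" for i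
    by (auto simp: mat_def split: if_splits)
  show "bij_betw (\<lambda>(j, r, p). p) {(j, r, p). r < nat (mat 1 $ i $ j :: int) \<and> p < d j} {..<d i}" for i
    unfolding * by (auto simp: bij_betw_def inj_on_def image_image)
  show "e j p q = (\<Sum>i\<in>UNIV. \<Sum>r<nat (mat 1 $ i $ j :: int).
      e i (case (j, r, p) of (j, r, p) \<Rightarrow> p) (case (j, r, q) of (j, r, p) \<Rightarrow> p))" for j p q
  proof -
    have "(\<Sum>r<nat (mat 1 $ i $ j :: int). e i p q) = (if i = j then e j p q else 0)" for i
      by (simp add: mat_def)
    then show ?thesis by simp
  qed
qed

section \<open>Relabelling the rows of a system\<close>

lemma matrix_units_relabel:
  assumes g: "matrix_units d g" and \<rho>: "\<And>i. bij_betw (\<rho> i) {..<d i} {..<d i}"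
  shows "matrix_units d (\<lambda>i p q. g i (\<rho> i p) (\<rho> i q))"
proof -
  have range: "\<rho> i p < d i" if "p < d i" for i p using bij_betwE[OF \<rho>] that by simp
  have inj: "\<rho> i p = \<rho> i q \<longleftrightarrow> p = q" if "p < d i" "q < d i" for i p q
    using inj_onD[OF bij_betw_imp_inj_on[OF \<rho>], of i p q] that by auto
  have "(\<Sum>j\<in>UNIV. \<Sum>p<d j. g j (\<rho> j p) (\<rho> j p)) = (\<Sum>j\<in>UNIV. \<Sum>p<d j. g j p p)"
    by (intro sum.cong refl sum.reindex_bij_betw[OF \<rho>])
  then show ?thesis using g unfolding matrix_units_def by (auto simp: range inj)
qed

lemma matrix_algebra_relabel:
  assumes \<rho>: "\<And>i. bij_betw (\<rho> i) {..<d i} {..<d i}"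
  shows "matrix_algebra d g \<subseteq> matrix_algebra d (\<lambda>i p q. g i (\<rho> i p) (\<rho> i q))"
proof -
  let ?h = "\<lambda>i p q. g i (\<rho> i p) (\<rho> i q)"
  have "unit_graph d g g \<subseteq> unit_graph d ?h ?h"
  proof (rule unit_graph_subset)
    fix i p q assume "p < d i" "q < d i"
    then obtain p' q' where "p' < d i" "q' < d i" "p = \<rho> i p'" "q = \<rho> i q'"
      using bij_betw_imp_surj_on[OF \<rho>, of i] by (metis imageE lessThan_iff)
    then show "(g i p q, g i p q) \<in> unit_graph d ?h ?h"
      using unit_graph_unit[of p' d i q' ?h ?h] by simp
  qed
  from image_mono[OF this, of fst] show ?thesis by (simp add: fst_unit_graph)
qed

text \<open>
  The row numberings \<open>\<sigma>\<close> and \<open>\<sigma>'\<close> of the two diagrams may differ; \<open>\<rho>\<close> relabels the rows of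
  the second diagram level by level so that they agree. This replaces the usual unitary
  conjugations.
\<close>

lemma cstar_isomorphic_of_same_incidence:
  fixes e :: "nat \<Rightarrow> 'n::finite \<Rightarrow> nat \<Rightarrow> nat \<Rightarrow> 'a::cstar_algebra"
    and g :: "nat \<Rightarrow> 'n::finite \<Rightarrow> nat \<Rightarrow> nat \<Rightarrow> 'b::cstar_algebra"
  assumes e: "\<And>k. matrix_units (d k) (e k)" and g: "\<And>k. matrix_units (d k) (g k)"
    and inc_e: "\<And>k. incidence (J k) (d k) (e k) (d (Suc k)) (e (Suc k))"
    and inc_g: "\<And>k. incidence (J k) (d k) (g k) (d (Suc k)) (g (Suc k))"
    and dense_e: "closure (\<Union>k. matrix_algebra (d k) (e k)) = UNIV"
    and dense_g: "closure (\<Union>k. matrix_algebra (d k) (g k)) = UNIV"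
  shows "cstar_isomorphic TYPE('a) TYPE('b)"
proof -
  define M where "M k i j = {..<nat (J k $ i $ j)}" for k i j
  have "\<forall>k. \<exists>\<sigma>. block_embedding (M k) \<sigma> (d k) (e k) (d (Suc k)) (e (Suc k))"
    "\<forall>k. \<exists>\<sigma>. block_embedding (M k) \<sigma> (d k) (g k) (d (Suc k)) (g (Suc k))"
    using inc_e inc_g unfolding incidence_iff_block_embedding M_def[abs_def] by blast+
  then obtain \<sigma> \<sigma>' where \<sigma>: "\<And>k. block_embedding (M k) (\<sigma> k) (d k) (e k) (d (Suc k)) (e (Suc k))"
    and \<sigma>': "\<And>k. block_embedding (M k) (\<sigma>' k) (d k) (g k) (d (Suc k)) (g (Suc k))"
    by metis
  have bij: "bij_betw (\<sigma> k i) (block_rows (M k i) (d k)) {..<d (Suc k) i}"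
    "bij_betw (\<sigma>' k i) (block_rows (M k i) (d k)) {..<d (Suc k) i}" for k i
    using \<sigma> \<sigma>' unfolding block_embedding_def by blast+
  \<comment> \<open>A row of level \<open>Suc k\<close> is decoded with \<open>\<sigma>\<close>, its
    inner row is relabelled by the previous \<open>\<rho>\<close>, and the result is encoded with
    \<open>\<sigma>'\<close>. Level 0 keeps its labels.\<close>
  define \<rho> where "\<rho> = rec_nat (\<lambda>i p. p)
    (\<lambda>k \<rho> i x. \<sigma>' k i ((\<lambda>(j, r, p). (j, r, \<rho> j p)) (inv_into (block_rows (M k i) (d k)) (\<sigma> k i) x)))"
  have \<rho>_0: "\<rho> 0 = (\<lambda>i p. p)"
    and \<rho>_Suc: "\<rho> (Suc k) = (\<lambda>i. \<sigma>' k i \<circ> ((\<lambda>(j, r, p). (j, r, \<rho> k j p)) \<circ> inv_into (block_rows (M k i) (d k)) (\<sigma> k i)))" for k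
    by (simp_all add: \<rho>_def fun_eq_iff)
  have \<rho>: "bij_betw (\<rho> k i) {..<d k i} {..<d k i}" for k i
  proof (induction k arbitrary: i)
    case 0
    show ?case by (simp add: \<rho>_0 bij_betw_def)
  next
    case (Suc k)
    have "bij_betw (\<lambda>(j, r, p). (j, r, \<rho> k j p)) (block_rows (M k i) (d k)) (block_rows (M k i) (d k))"
    proof (rule bij_betw_byWitness[where f' = "\<lambda>(j, r, p). (j, r, inv_into {..<d k j} (\<rho> k j) p)"])
      show "\<forall>a\<in>block_rows (M k i) (d k). (\<lambda>(j, r, p). (j, r, inv_into {..<d k j} (\<rho> k j) p)) ((\<lambda>(j, r, p). (j, r, \<rho> k j p)) a) = a"
        using bij_betw_inv_into_left[OF Suc] by (auto simp: block_rows_def)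
      show "\<forall>a\<in>block_rows (M k i) (d k). (\<lambda>(j, r, p). (j, r, \<rho> k j p)) ((\<lambda>(j, r, p). (j, r, inv_into {..<d k j} (\<rho> k j) p)) a) = a"
        using bij_betw_inv_into_right[OF Suc] by (auto simp: block_rows_def)
      show "(\<lambda>(j, r, p). (j, r, \<rho> k j p)) ` block_rows (M k i) (d k) \<subseteq> block_rows (M k i) (d k)"
        using bij_betwE[OF Suc] by (auto simp: block_rows_def)
      show "(\<lambda>(j, r, p). (j, r, inv_into {..<d k j} (\<rho> k j) p)) ` block_rows (M k i) (d k) \<subseteq> block_rows (M k i) (d k)"
        using bij_betwE[OF bij_betw_inv_into[OF Suc]] by (auto simp: block_rows_def)
    qed
    then show ?case
      unfolding \<rho>_Suc by (rule bij_betw_trans[OF bij_betw_trans[OF bij_betw_inv_into[OF bij(1)]] bij(2)])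
  qed
  have \<rho>_\<sigma>: "\<rho> (Suc k) i (\<sigma> k i (j, r, p)) = \<sigma>' k i (j, r, \<rho> k j p)" if "r \<in> M k i j" "p < d k j" for k i j r p
  proof -
    have "inv_into (block_rows (M k i) (d k)) (\<sigma> k i) (\<sigma> k i (j, r, p)) = (j, r, p)"
      using that by (intro bij_betw_inv_into_left[OF bij(1)]) (simp add: block_rows_def)
    then show ?thesis by (simp add: \<rho>_Suc)
  qed
  define h where "h k i p q = g k i (\<rho> k i p) (\<rho> k i q)" for k i p q
  have h: "matrix_units (d k) (h k)" for k
    unfolding h_def[abs_def] by (rule matrix_units_relabel[OF g \<rho>])
  have "block_embedding (M k) (\<sigma> k) (d k) (h k) (d (Suc k)) (h (Suc k))" for k
    unfolding block_embedding_def
  proof (intro conjI allI impI bij)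
    fix j p q assume pq: "p < d k j" "q < d k j"
    then have "\<rho> k j p < d k j" "\<rho> k j q < d k j" using bij_betwE[OF \<rho>] by auto
    then have "h k j p q = (\<Sum>i\<in>UNIV. \<Sum>r\<in>M k i j. g (Suc k) i (\<sigma>' k i (j, r, \<rho> k j p)) (\<sigma>' k i (j, r, \<rho> k j q)))"
      using \<sigma>' unfolding block_embedding_def h_def by blast
    also have "\<dots> = (\<Sum>i\<in>UNIV. \<Sum>r\<in>M k i j. h (Suc k) i (\<sigma> k i (j, r, p)) (\<sigma> k i (j, r, q)))"
      unfolding h_def using pq by (intro sum.cong refl) (simp add: \<rho>_\<sigma>)
    finally show "h k j p q = (\<Sum>i\<in>UNIV. \<Sum>r\<in>M k i j. h (Suc k) i (\<sigma> k i (j, r, p)) (\<sigma> k i (j, r, q)))" .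
  qed
  then have step: "unit_graph (d k) (e k) (h k) \<subseteq> unit_graph (d (Suc k)) (e (Suc k)) (h (Suc k))" for k
    by (rule block_embedding_unit_graph[OF \<sigma>])
  have "matrix_algebra (d k) (g k) \<subseteq> matrix_algebra (d k) (h k)" for k
    unfolding h_def[abs_def] by (rule matrix_algebra_relabel[OF \<rho>])
  then have "closure (\<Union>k. matrix_algebra (d k) (g k)) \<subseteq> closure (\<Union>k. matrix_algebra (d k) (h k))"
    by (intro closure_mono UN_mono) auto
  then have "closure (\<Union>k. matrix_algebra (d k) (h k)) = UNIV" using dense_g by auto
  then show ?thesis
    by (rule cstar_isomorphic_of_matched_units[OF e h step dense_e])
qed

section \<open>Telescoping and intertwining\<close>

lemma incidence_matrix_algebra:
  assumes "incidence J d e d' e'"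
  shows "matrix_algebra d e \<subseteq> matrix_algebra d' e'"
  using assms block_embedding_matrix_algebra unfolding incidence_iff_block_embedding by blast

lemma nonneg_mat_mult:
  fixes J :: "int^'n::finite^'n" and J' :: "int^'n^'n"
  assumes "nonneg_mat J'" "nonneg_mat J" shows "nonneg_mat (J' ** J)"
  using assms by (auto simp: nonneg_mat_def matrix_matrix_mult_def intro!: sum_nonneg)

text \<open>Composing one step at a time yields a product of copies of \<open>J\<close>. It acts on
  vectors as \<open>K\<close> does, and a matrix is determined by this action.\<close>

lemma incidence_telescope:
  fixes J K :: "int^'n::finite^'n"
  assumes J: "nonneg_mat J" and step: "\<And>n. incidence J (d n) (e n) (d (Suc n)) (e (Suc n))"
    and "n \<le> n'" and K: "\<And>x. K *v x = ((*v) J ^^ (n' - n)) x"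
  shows "incidence K (d n) (e n) (d n') (e n')"
proof -
  have "\<exists>K. nonneg_mat K \<and> (\<forall>x. K *v x = ((*v) J ^^ m) x) \<and> incidence K (d n) (e n) (d (n + m)) (e (n + m))" for m
  proof (induction m)
    case 0
    show ?case
      by (intro exI[of _ "mat 1"]) (simp add: incidence_refl, simp add: nonneg_mat_def mat_def)
  next
    case (Suc m)
    then obtain K where K: "nonneg_mat K" "\<And>x. K *v x = ((*v) J ^^ m) x"
      "incidence K (d n) (e n) (d (n + m)) (e (n + m))" by blast
    show ?case
      using incidence_mult[OF K(1) J K(3) step] K(2) nonneg_mat_mult[OF J K(1)]
      by (intro exI[of _ "J ** K"]) (simp flip: matrix_vector_mul_assoc)
  qed
  from this[of "n' - n"] obtain K' where K': "\<And>x. K' *v x = ((*v) J ^^ (n' - n)) x"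
    "incidence K' (d n) (e n) (d n') (e n')" using \<open>n \<le> n'\<close> by auto
  then have "K = K'" using K by (simp add: matrix_eq)
  with K' show ?thesis by simp
qed

lemma funpow_nonneg_mat:
  fixes J :: "int^'n::finite^'n"
  assumes "nonneg_mat J" "\<And>i. 0 \<le> u $ i"
  shows "0 \<le> (((*v) J ^^ n) u) $ i"
proof (induction n arbitrary: i)
  case (Suc n)
  have "0 \<le> (J *v v) $ i" if "\<And>i. 0 \<le> v $ i" for v
    using that assms(1) by (auto simp: matrix_vector_mult_def nonneg_mat_def intro!: sum_nonneg)
  from this[OF Suc] show ?case by simp
qed (use assms in simp)

text \<open>The factorisation \<open>Q k ** P k\<close> inserts units \<open>f k\<close> into the
  first algebra between levels \<open>n k\<close> and \<open>n (Suc k)\<close>. Then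
  \<open>f\<close> and the levels \<open>m k\<close> of the second algebra have the same sizes and
  the same incidence matrices \<open>P (Suc k) ** Q k\<close>, so
  \<open>cstar_isomorphic_of_same_incidence\<close> applies.\<close>

lemma cstar_isomorphic_of_intertwining:
  fixes J1 J2 :: "int^'n::finite^'n" and P Q :: "nat \<Rightarrow> int^'n^'n" and n m :: "nat \<Rightarrow> nat"
  assumes AF1: "AF_with_incidence_matrix TYPE('a::cstar_algebra) J1 u1"
    and AF2: "AF_with_incidence_matrix TYPE('b::cstar_algebra) J2 u2"
    and J: "nonneg_mat J1" "nonneg_mat J2" and u: "\<And>i. 0 \<le> u1 $ i" "\<And>i. 0 \<le> u2 $ i"
    and P: "\<And>k. nonneg_mat (P k)" and Q: "\<And>k. nonneg_mat (Q k)"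
    and nonzero: "\<And>k i. \<exists>j. Q k $ j $ i > 0"
    and n: "strict_mono n" and m: "strict_mono m"
    and Pu: "\<And>k. P k *v (((*v) J1 ^^ n k) u1) = ((*v) J2 ^^ m k) u2"
    and QP: "\<And>k x. Q k *v (P k *v x) = ((*v) J1 ^^ (n (Suc k) - n k)) x"
    and PQ: "\<And>k x. P (Suc k) *v (Q k *v x) = ((*v) J2 ^^ (m (Suc k) - m k)) x"
  shows "cstar_isomorphic TYPE('a) TYPE('b)"
proof -
  define s where "s = summand_size J1 u1"
  define t where "t = summand_size J2 u2"
  obtain e :: "nat \<Rightarrow> 'n \<Rightarrow> nat \<Rightarrow> nat \<Rightarrow> 'a" where e: "\<And>n. matrix_units (s n) (e n)"
    and inc_e: "\<And>n. incidence J1 (s n) (e n) (s (Suc n)) (e (Suc n))"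
    and dense_e: "closure (\<Union>n. matrix_algebra (s n) (e n)) = UNIV"
    using AF1 unfolding AF_with_incidence_matrix_def s_def by blast
  obtain g :: "nat \<Rightarrow> 'n \<Rightarrow> nat \<Rightarrow> nat \<Rightarrow> 'b" where g: "\<And>n. matrix_units (t n) (g n)"
    and inc_g: "\<And>n. incidence J2 (t n) (g n) (t (Suc n)) (g (Suc n))"
    and dense_g: "closure (\<Union>n. matrix_algebra (t n) (g n)) = UNIV"
    using AF2 unfolding AF_with_incidence_matrix_def t_def by blast
  \<comment> \<open>By \<open>Pu\<close> the sizes that \<open>P k\<close> prescribes for the
    inserted level are those of level \<open>m k\<close> of the second diagram.\<close>
  have "int (t (m k) i) = (\<Sum>j\<in>UNIV. P k $ i $ j * int (s (n k) j))" for k i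
    using arg_cong[OF Pu, of "\<lambda>v. v $ i" k] funpow_nonneg_mat[OF J(1) u(1)] funpow_nonneg_mat[OF J(2) u(2)]
    by (simp add: s_def t_def summand_size_def matrix_vector_mult_def)
  moreover have "incidence (Q k ** P k) (s (n k)) (e (n k)) (s (n (Suc k))) (e (n (Suc k)))" for k
    by (rule incidence_telescope[where d = s and e = e, OF J(1) inc_e])
      (use strict_mono_less_eq[OF n] QP in \<open>simp_all flip: matrix_vector_mul_assoc\<close>)
  ultimately have "\<exists>f. matrix_units (t (m k)) f \<and> incidence (P k) (s (n k)) (e (n k)) (t (m k)) f
      \<and> incidence (Q k) (t (m k)) f (s (n (Suc k))) (e (n (Suc k)))" for k
    by (intro incidence_factor P Q e nonzero)
  then obtain f where f: "\<And>k. matrix_units (t (m k)) (f k)"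
    and inc_P: "\<And>k. incidence (P k) (s (n k)) (e (n k)) (t (m k)) (f k)"
    and inc_Q: "\<And>k. incidence (Q k) (t (m k)) (f k) (s (n (Suc k))) (e (n (Suc k)))"
    by metis
  show ?thesis
  proof (rule cstar_isomorphic_of_same_incidence)
    show "matrix_units (t (m k)) (f k)" "matrix_units (t (m k)) (g (m k))" for k by (rule f, rule g)
    show "incidence (P (Suc k) ** Q k) (t (m k)) (f k) (t (m (Suc k))) (f (Suc k))" for k
      by (rule incidence_mult[OF Q P inc_Q inc_P])
    show "incidence (P (Suc k) ** Q k) (t (m k)) (g (m k)) (t (m (Suc k))) (g (m (Suc k)))" for k
      by (rule incidence_telescope[where d = t and e = g, OF J(2) inc_g])
        (use strict_mono_less_eq[OF m] PQ in \<open>simp_all flip: matrix_vector_mul_assoc\<close>)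
    \<comment> \<open>Since \<open>k \<le> n k\<close>, every original level lies inside an inserted
      one, which carries density over.\<close>
    have sub_e: "matrix_algebra (s k) (e k) \<subseteq> matrix_algebra (t (m k)) (f k)" for k
      using lift_Suc_mono_le[of "\<lambda>k. matrix_algebra (s k) (e k)", OF incidence_matrix_algebra[OF inc_e]
          strict_mono_imp_increasing[OF n], of k] incidence_matrix_algebra[OF inc_P, of k] by blast
    have sub_g: "matrix_algebra (t k) (g k) \<subseteq> matrix_algebra (t (m k)) (g (m k))" for k
      by (rule lift_Suc_mono_le[of "\<lambda>k. matrix_algebra (t k) (g k)", OF incidence_matrix_algebra[OF inc_g]
          strict_mono_imp_increasing[OF m]])
    have "closure (\<Union>k. matrix_algebra (s k) (e k)) \<subseteq> closure (\<Union>k. matrix_algebra (t (m k)) (f k))"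
      "closure (\<Union>k. matrix_algebra (t k) (g k)) \<subseteq> closure (\<Union>k. matrix_algebra (t (m k)) (g (m k)))"
      using sub_e sub_g by (intro closure_mono UN_mono; blast)+
    then show "closure (\<Union>k. matrix_algebra (t (m k)) (f k)) = UNIV"
      "closure (\<Union>k. matrix_algebra (t (m k)) (g (m k))) = UNIV" using dense_e dense_g by auto
  qed
qed

section \<open>Eigencoordinates\<close>

lemma prime_factors_power_subset:
  fixes a :: int
  assumes "a \<noteq> 0"
  shows "prime_factors (a ^ n) \<subseteq> prime_factors a"
  using assms by (auto simp: prime_factors_dvd dest: prime_dvd_power)

lemma eventually_dvd_power:
  fixes a b :: int
  assumes "a \<noteq> 0" "b \<noteq> 0" "prime_factors a \<subseteq> prime_factors b"
  shows "\<forall>\<^sub>F m in sequentially. a dvd b ^ m"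
proof -
  \<comment> \<open>Each prime of \<open>a\<close> divides \<open>b\<close>, hence occurs at least
    \<open>m\<close> times in \<open>b ^ m\<close>, while its multiplicity in \<open>a\<close> is at
    most the total number of prime factors.\<close>
  have "a dvd b ^ m" if m: "m \<ge> size (prime_factorization a)" for m
  proof (rule multiplicity_le_imp_dvd)
    fix p :: int assume p: "prime p"
    show "multiplicity p a \<le> multiplicity p (b ^ m)"
    proof (cases "p \<in> prime_factors a")
      case True
      then have "multiplicity p b \<ge> 1"
        using assms(2,3) by (metis Suc_leI One_nat_def prime_factors_multiplicity mem_Collect_eq subsetD)
      then have "m \<le> multiplicity p (b ^ m)"
        using assms(2) p by (subst prime_elem_multiplicity_power_distrib) auto
      moreover have "multiplicity p a \<le> size (prime_factorization a)"
        using count_le_size[of "prime_factorization a" p] p by (simp add: count_prime_factorization_prime)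
      ultimately show ?thesis using m by simp
    next
      case False
      then show ?thesis using p assms(1) by (simp add: prime_factors_multiplicity)
    qed
  qed (use assms in simp)
  then show ?thesis unfolding eventually_sequentially by blast
qed

lemma Z_inverse_subset:
  assumes "l \<noteq> 0" "l' \<noteq> 0" "prime_factors l \<subseteq> prime_factors l'"
  shows "Z_inverse l \<subseteq> Z_inverse l'"
proof
  fix x assume "x \<in> Z_inverse l"
  then obtain a n where x: "x = of_int a / of_int l ^ n" unfolding Z_inverse_def by blast
  have "prime_factors (l ^ n) \<subseteq> prime_factors l'"
    using prime_factors_power_subset[OF assms(1)] assms(3) by blast
  then obtain m where "l ^ n dvd l' ^ m"
    using eventually_dvd_power[of "l ^ n" l'] assms(1,2) by (auto simp: eventually_sequentially)
  then obtain c where c: "l' ^ m = l ^ n * c" by (elim dvdE)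
  then have c': "of_int l' ^ m = (of_int l ^ n * of_int c :: rat)" by (metis of_int_mult of_int_power)
  have "c \<noteq> 0" using c assms(2) by auto
  then have "x = of_int (a * c) / of_int l' ^ m" unfolding x c' by simp
  then show "x \<in> Z_inverse l'" unfolding Z_inverse_def by blast
qed

section \<open>Eigencoordinates of the incidence matrix\<close>

definition rat_vec :: "int^2 \<Rightarrow> rat^2" where
  "rat_vec g = (\<chi> i. rat_of_int (g $ i))"

text \<open>
  The left eigenvectors of \<open>incidence_matrix k l\<close> are \<open>(1, 1/l)\<close> and \<open>(1, -1/k)\<close>, with
  eigenvalues \<open>l\<close> and \<open>-k\<close>; so \<open>eigen_coord l\<close> and \<open>eigen_coord (-k)\<close> diagonalise it.
\<close>

definition eigen_coord :: "int \<Rightarrow> rat^2 \<Rightarrow> rat" where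
  "eigen_coord a g = g $ 1 + g $ 2 / of_int a"

abbreviation rat_incidence_matrix :: "int \<Rightarrow> int \<Rightarrow> rat^2^2" where
  "rat_incidence_matrix k l \<equiv> \<chi> i j. rat_of_int (incidence_matrix k l $ i $ j)"

lemma eigen_coord_add: "eigen_coord a (g + h) = eigen_coord a g + eigen_coord a h"
  by (simp add: eigen_coord_def add_divide_distrib)

text \<open>The coordinate change has determinant \<open>-(k + l) / (k * l)\<close>.\<close>

lemma eigen_coord_inject:
  assumes "l \<noteq> 0" "k \<noteq> 0" "k + l \<noteq> 0"
    and "eigen_coord l g = eigen_coord l h" "eigen_coord (- k) g = eigen_coord (- k) h"
  shows "g = h"
proof -
  have kl: "rat_of_int k \<noteq> 0" "rat_of_int l \<noteq> 0" using assms by simp_all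
  have kl': "rat_of_int k + rat_of_int l \<noteq> 0" using assms(3) by (metis of_int_add of_int_eq_0_iff)
  let ?u = "g $ 1 - h $ 1" and ?v = "g $ 2 - h $ 2"
  have "?u * of_int l + ?v = 0" "?u * of_int k - ?v = 0"
    using assms(4,5) kl by (simp_all add: eigen_coord_def field_simps)
  then have "?u * (of_int k + of_int l) = 0" by (simp add: algebra_simps)
  then have "?u = 0" using kl' by simp
  then have "?v = 0" using \<open>?u * of_int k - ?v = 0\<close> by simp
  with \<open>?u = 0\<close> show ?thesis by (simp add: vec_eq_iff forall_2)
qed

lemma eigen_coord_incidence_matrix:
  assumes "l \<noteq> 0" "k \<noteq> 0"
  shows "eigen_coord l (rat_incidence_matrix k l *v g) = of_int l * eigen_coord l g"
    and "eigen_coord (- k) (rat_incidence_matrix k l *v g) = of_int (- k) * eigen_coord (- k) g"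
  using assms by (simp_all add: eigen_coord_def incidence_matrix_def matrix_vector_mult_def sum_2 field_simps)

lemma eigen_coord_incidence_matrix_power:
  assumes "l \<noteq> 0" "k \<noteq> 0"
  shows "eigen_coord l (((*v) (rat_incidence_matrix k l) ^^ n) g) = of_int l ^ n * eigen_coord l g"
    and "eigen_coord (- k) (((*v) (rat_incidence_matrix k l) ^^ n) g) = of_int (- k) ^ n * eigen_coord (- k) g"
  by (induction n) (simp_all only: funpow.simps id_apply comp_apply power_0 power_Suc mult_1_left
      eigen_coord_incidence_matrix[OF assms] mult.assoc)

lemma rat_vec_incidence_matrix_power:
  "rat_vec (((*v) (incidence_matrix k l) ^^ n) g) = ((*v) (rat_incidence_matrix k l) ^^ n) (rat_vec g)"
proof -
  have "rat_vec (incidence_matrix k l *v g) = rat_incidence_matrix k l *v rat_vec g" for g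
    by (simp add: rat_vec_def matrix_vector_mult_def vec_eq_iff)
  then show ?thesis by (induction n) simp_all
qed

lemma rat_vec_inject: "rat_vec g = rat_vec h \<longleftrightarrow> g = h"
  by (simp add: rat_vec_def vec_eq_iff)

text \<open>
  In eigencoordinates the \<open>n\<close>-th copy of \<open>\<int>\<^sup>2\<close> in the limit is scaled by
  \<open>diag(l, -k) ^ -n\<close>; \<open>intertwines\<close> says that \<open>P\<close>, from level \<open>n\<close> of the first system to
  level \<open>m\<close> of the second, induces the identity on the limit.
\<close>

definition intertwines :: "int \<Rightarrow> int \<Rightarrow> nat \<Rightarrow> int \<Rightarrow> int \<Rightarrow> nat \<Rightarrow> int^2^2 \<Rightarrow> bool" where
  "intertwines k1 l1 n k2 l2 m P \<longleftrightarrow> (\<forall>g.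
     eigen_coord l2 (rat_vec (P *v g)) * of_int l1 ^ n = of_int l2 ^ m * eigen_coord l1 (rat_vec g) \<and>
     eigen_coord (- k2) (rat_vec (P *v g)) * of_int (- k1) ^ n
       = of_int (- k2) ^ m * eigen_coord (- k1) (rat_vec g))"

text \<open>Maps inducing the identity on the limit compose to one that does so from level
  \<open>n\<close> to level \<open>n'\<close> of a single system, which is a power of its matrix. In
  each eigencoordinate this is a cancellation of powers.\<close>

lemma intertwines_round_trip:
  assumes kl: "k1 > 0" "l1 > 0" "k2 > 0" "l2 > 0"
    and P: "intertwines k1 l1 n k2 l2 m P" and Q: "intertwines k2 l2 m k1 l1 n' Q" and "n \<le> n'"
  shows "Q *v (P *v g) = ((*v) (incidence_matrix k1 l1) ^^ (n' - n)) g"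
proof -
  have cancel: "z = a ^ (n' - n) * x"
    if "z * b ^ m = a ^ n' * y" "y * a ^ n = b ^ m * x" "a \<noteq> 0" "b \<noteq> 0" for x y z a b :: rat
  proof -
    have "z * b ^ m * a ^ n = a ^ (n' - n) * x * b ^ m * a ^ n"
    proof -
      have "a ^ n' = a ^ (n' - n) * a ^ n" using \<open>n \<le> n'\<close> by (simp flip: power_add)
      then have "z * b ^ m * a ^ n = a ^ (n' - n) * a ^ n * (y * a ^ n)" unfolding that(1) by (simp add: mult_ac)
      then show ?thesis unfolding that(2) by (simp add: mult_ac)
    qed
    then show ?thesis using that(3,4) by simp
  qed
  have "rat_vec (Q *v (P *v g)) = ((*v) (rat_incidence_matrix k1 l1) ^^ (n' - n)) (rat_vec g)"
  proof (rule eigen_coord_inject[of l1 k1])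
    show "eigen_coord l1 (rat_vec (Q *v (P *v g)))
        = eigen_coord l1 (((*v) (rat_incidence_matrix k1 l1) ^^ (n' - n)) (rat_vec g))"
      using kl P Q
      by (subst eigen_coord_incidence_matrix_power)
        (auto simp: intertwines_def intro: cancel[where b = "of_int l2"])
    show "eigen_coord (- k1) (rat_vec (Q *v (P *v g)))
        = eigen_coord (- k1) (((*v) (rat_incidence_matrix k1 l1) ^^ (n' - n)) (rat_vec g))"
      using kl P Q
      by (subst eigen_coord_incidence_matrix_power)
        (auto simp: intertwines_def simp del: of_int_minus intro: cancel[where b = "of_int (- k2)"])
  qed (use kl in auto)
  then show ?thesis by (simp add: rat_vec_inject flip: rat_vec_incidence_matrix_power)
qed

text \<open>Both eigencoordinates of \<open>axis 1 1\<close> are 1 in either system, so it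
  represents the same element of the limit.\<close>

lemma intertwines_unit:
  assumes kl: "k1 > 0" "l1 > 0" "k2 > 0" "l2 > 0"
    and P: "intertwines k1 l1 n k2 l2 m P"
  shows "P *v (((*v) (incidence_matrix k1 l1) ^^ n) (axis 1 1)) = ((*v) (incidence_matrix k2 l2) ^^ m) (axis 1 1)"
proof -
  let ?u = "rat_vec (axis 1 1)" and ?v = "((*v) (incidence_matrix k1 l1) ^^ n) (axis 1 1)"
  have unit: "eigen_coord a ?u = 1" for a by (simp add: eigen_coord_def rat_vec_def axis_def)
  have "rat_vec (P *v ?v) = ((*v) (rat_incidence_matrix k2 l2) ^^ m) ?u"
  proof (rule eigen_coord_inject[of l2 k2])
    have "eigen_coord l2 (rat_vec (P *v ?v)) * of_int l1 ^ n = of_int l2 ^ m * of_int l1 ^ n"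
      using P kl by (simp add: intertwines_def rat_vec_incidence_matrix_power eigen_coord_incidence_matrix_power unit)
    then show "eigen_coord l2 (rat_vec (P *v ?v)) = eigen_coord l2 (((*v) (rat_incidence_matrix k2 l2) ^^ m) ?u)"
      using kl by (simp add: eigen_coord_incidence_matrix_power unit)
    have "eigen_coord (- k2) (rat_vec (P *v ?v)) * of_int (- k1) ^ n = of_int (- k2) ^ m * of_int (- k1) ^ n"
      using P kl by (simp add: intertwines_def rat_vec_incidence_matrix_power eigen_coord_incidence_matrix_power unit
          del: of_int_minus)
    then show "eigen_coord (- k2) (rat_vec (P *v ?v)) = eigen_coord (- k2) (((*v) (rat_incidence_matrix k2 l2) ^^ m) ?u)"
      using kl by (simp add: eigen_coord_incidence_matrix_power unit del: of_int_minus)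
  qed (use kl in auto)
  then show ?thesis by (simp add: rat_vec_inject flip: rat_vec_incidence_matrix_power)
qed

lemma eventually_power_dominates:
  fixes a b c d :: int
  assumes "0 < b" "b < a" "0 < c"
  shows "\<forall>\<^sub>F m in sequentially. b ^ m * d < a ^ m * c"
proof -
  have "1 < real_of_int a / real_of_int b" using assms by simp
  then obtain m where m: "real_of_int d / real_of_int c < (real_of_int a / real_of_int b) ^ m"
    using real_arch_pow by blast
  have "\<forall>\<^sub>F m in sequentially. real_of_int d / real_of_int c < (real_of_int a / real_of_int b) ^ m"
    using eventually_ge_at_top[of m]
  proof eventually_elim
    case (elim m')
    then have "(real_of_int a / real_of_int b) ^ m \<le> (real_of_int a / real_of_int b) ^ m'"
      using \<open>1 < _\<close> by (intro power_increasing) auto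
    with m show ?case by simp
  qed
  then show ?thesis
  proof eventually_elim
    case (elim m)
    then have "real_of_int (b ^ m * d) < real_of_int (a ^ m * c)"
      using assms by (simp add: power_divide field_simps)
    then show ?case by (simp only: of_int_less_iff)
  qed
qed

text \<open>In eigencoordinates \<open>P\<close> has to be
  \<open>diag(l2 ^ m / l1 ^ n, (-k2) ^ m / (-k1) ^ n)\<close>. Changing coordinates introduces the
  denominators \<open>l1\<close>, \<open>k1\<close> and \<open>l2 + k2\<close>. By the hypotheses on
  primes, large powers of \<open>l2\<close> and \<open>k2\<close> clear them, and since
  \<open>k2 < l2\<close> the first diagonal entry eventually dominates, which makes \<open>P\<close>
  positive.\<close>

lemma ex_intertwines:
  assumes kl: "0 < k1" "k1 < l1" "0 < k2" "k2 < l2"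
    and k: "prime_factors k1 \<subseteq> prime_factors k2" and l: "prime_factors l1 \<subseteq> prime_factors l2"
    and sum: "prime_factors (l2 + k2) \<subseteq> prime_factors l2 \<inter> prime_factors k2"
  shows "\<exists>m>n. \<exists>P. (\<forall>i j. 0 < P $ i $ j) \<and> intertwines k1 l1 n k2 l2 m P"
proof -
  define s where "s = l2 + k2"
  have s: "s > 0" using kl by (simp add: s_def)
  \<comment> \<open>The additional factor \<open>l1\<close> in \<open>l1 ^ Suc n\<close> clears the
    denominator in \<open>g $ 1 + g $ 2 / l1\<close>; \<open>k1\<close> does the same for the other
    coordinate.\<close>
  have "prime_factors (s * l1 ^ Suc n) \<subseteq> prime_factors l2"
    using l sum kl s prime_factors_power_subset[of l1 "Suc n"]
    by (auto simp add: prime_factors_product s_def simp del: power_Suc)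
  then have "\<forall>\<^sub>F m in sequentially. s * l1 ^ Suc n dvd l2 ^ m"
    using kl s by (intro eventually_dvd_power) auto
  moreover have "prime_factors (s * k1 ^ Suc n) \<subseteq> prime_factors k2"
    using k sum kl s prime_factors_power_subset[of k1 "Suc n"]
    by (auto simp add: prime_factors_product s_def simp del: power_Suc)
  then have "\<forall>\<^sub>F m in sequentially. s * k1 ^ Suc n dvd k2 ^ m"
    using kl s by (intro eventually_dvd_power) auto
  \<comment> \<open>After cancelling common factors this becomes
    \<open>\<gamma> < \<alpha>\<close>.\<close>
  moreover have "\<forall>\<^sub>F m in sequentially. k2 ^ m * l1 ^ Suc n < l2 ^ m * k1 ^ Suc n"
    using kl by (intro eventually_power_dominates) auto
  moreover have "\<forall>\<^sub>F m in sequentially. n < m" by (rule eventually_gt_at_top)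
  ultimately have "\<forall>\<^sub>F m in sequentially. s * l1 ^ Suc n dvd l2 ^ m \<and> s * k1 ^ Suc n dvd k2 ^ m \<and>
      k2 ^ m * l1 ^ Suc n < l2 ^ m * k1 ^ Suc n \<and> n < m"
    by (intro eventually_conj)
  then obtain m where m: "s * l1 ^ Suc n dvd l2 ^ m" "s * k1 ^ Suc n dvd k2 ^ m"
    "k2 ^ m * l1 ^ Suc n < l2 ^ m * k1 ^ Suc n" "n < m"
    by (auto simp: eventually_sequentially)
  obtain \<alpha> where \<alpha>: "l2 ^ m = s * l1 ^ Suc n * \<alpha>" using m(1) by (elim dvdE)
  obtain \<gamma> where \<gamma>: "k2 ^ m = s * k1 ^ Suc n * \<gamma>" using m(2) by (elim dvdE)
  have "\<gamma> > 0" using \<gamma> kl s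
    by (metis zero_less_mult_pos zero_less_power mult_pos_pos)
  have "(s * k1 ^ Suc n * l1 ^ Suc n) * \<gamma> < (s * k1 ^ Suc n * l1 ^ Suc n) * \<alpha>"
    using m(3) unfolding \<alpha> \<gamma> by (simp add: algebra_simps)
  then have "\<gamma> < \<alpha>" using kl s by (simp add: mult_less_cancel_left)
  \<comment> \<open>The sign of \<open>\<beta>\<close> depends on parities; positivity of
    \<open>P\<close> uses only that its absolute value is below \<open>\<alpha>\<close>.\<close>
  define \<beta> where "\<beta> = (- 1) ^ m * (- 1) ^ Suc n * \<gamma>"
  have \<beta>: "(- k2) ^ m = s * (- k1) ^ Suc n * \<beta>"
  proof -
    have "(- k2) ^ m = (- 1) ^ m * k2 ^ m" "(- k1) ^ Suc n = (- 1) ^ Suc n * k1 ^ Suc n"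
      by (metis mult_minus1 power_mult_distrib)+
    then show ?thesis unfolding \<beta>_def \<gamma> by (simp add: algebra_simps flip: power_mult_distrib)
  qed
  have "\<bar>\<beta>\<bar> < \<alpha>" using \<open>\<gamma> < \<alpha>\<close> \<open>\<gamma> > 0\<close> by (simp add: \<beta>_def abs_mult power_abs)
  then have \<alpha>\<beta>: "- \<alpha> < \<beta>" "\<beta> < \<alpha>" "0 < \<alpha>" by auto
  have mono: "v * b < u * a" if "0 < v" "v \<le> u" "b < a" "0 < a" for u v a b :: int
    using that by (metis mult_le_less_imp_less mult_less_cancel_left_pos mult_right_mono order_less_le_trans less_imp_le)
  \<comment> \<open>The diagonal map with entries \<open>s * \<alpha> * l1\<close> and
    \<open>- s * \<beta> * k1\<close>, written in standard coordinates through
    \<open>g $ 1 = (l2 * x + k2 * y) / s\<close> and \<open>g $ 2 = k2 * l2 * (x - y) / s\<close>;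
    the factor \<open>s\<close> cancels.\<close>
  define P :: "int^2^2" where "P = vector
    [vector [l2 * (l1 * \<alpha>) - k2 * (k1 * \<beta>), l2 * \<alpha> + k2 * \<beta>],
     vector [k2 * l2 * (l1 * \<alpha> + k1 * \<beta>), k2 * l2 * (\<alpha> - \<beta>)]]"
  have ineqs: "k1 * \<beta> < l1 * \<alpha>" "k1 * (- \<beta>) < l1 * \<alpha>" "0 < l1 * \<alpha>" "k2 * (- \<beta>) < l2 * \<alpha>"
    by (rule mono mult_pos_pos; use kl \<alpha>\<beta> in simp)+
  have "k2 * (k1 * \<beta>) < l2 * (l1 * \<alpha>)"
    by (rule mono; use kl ineqs in simp)
  then have pos: "\<forall>i j. 0 < P $ i $ j"
    unfolding forall_2 P_def vector_2
    by (intro conjI mult_pos_pos; use kl ineqs \<alpha>\<beta> in linarith)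
  have s0: "rat_of_int l1 \<noteq> 0" "rat_of_int l2 \<noteq> 0" "rat_of_int k1 \<noteq> 0" "rat_of_int k2 \<noteq> 0" using kl by auto
  have \<alpha>': "rat_of_int l2 ^ m = (of_int l2 + of_int k2) * of_int l1 ^ Suc n * of_int \<alpha>"
    using arg_cong[OF \<alpha>, of rat_of_int] by (simp add: s_def)
  have \<beta>': "rat_of_int (- k2) ^ m = (of_int l2 + of_int k2) * of_int (- k1) ^ Suc n * of_int \<beta>"
    using arg_cong[OF \<beta>, of rat_of_int] by (simp add: s_def)
  have "intertwines k1 l1 n k2 l2 m P"
    unfolding intertwines_def \<alpha>' \<beta>'
  proof (intro allI conjI)
    fix g :: "int^2"
    have 1: "eigen_coord l2 (rat_vec (P *v g))
        = (of_int l2 + of_int k2) * of_int \<alpha> * (of_int l1 * eigen_coord l1 (rat_vec g))"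
      and 2: "eigen_coord (- k2) (rat_vec (P *v g))
        = (of_int l2 + of_int k2) * of_int \<beta> * (of_int (- k1) * eigen_coord (- k1) (rat_vec g))"
      using s0
      by (simp_all add: eigen_coord_def rat_vec_def P_def matrix_vector_mult_def sum_2 field_simps)
    show "eigen_coord l2 (rat_vec (P *v g)) * of_int l1 ^ n
        = (of_int l2 + of_int k2) * of_int l1 ^ Suc n * of_int \<alpha> * eigen_coord l1 (rat_vec g)"
      unfolding 1 by (simp add: mult_ac)
    show "eigen_coord (- k2) (rat_vec (P *v g)) * of_int (- k1) ^ n
        = (of_int l2 + of_int k2) * of_int (- k1) ^ Suc n * of_int \<beta> * eigen_coord (- k1) (rat_vec g)"
      unfolding 2 by (simp add: mult_ac)
  qed
  with pos m(4) show ?thesis by blast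
qed

section \<open>The dimension group\<close>

text \<open>Applying the matrix \<open>n\<close> times undoes \<open>n\<close> applications of its
  inverse. The forward form is the one that eigencoordinates can handle.\<close>

lemma dimension_group_eq:
  assumes "k \<noteq> 0" "l \<noteq> 0"
  shows "dimension_group (incidence_matrix k l)
    = {g. \<exists>n. \<forall>i. (((*v) (rat_incidence_matrix k l) ^^ n) g) $ i \<in> \<int>}"
proof -
  let ?A = "rat_incidence_matrix k l" and ?B = "matrix_inv (rat_incidence_matrix k l)"
  \<comment> \<open>\<open>matrix_inv\<close> is defined by choice; the explicit inverse
    \<open>C\<close> guarantees that the chosen matrix is an inverse.\<close>
  define C :: "rat^2^2" where "C = vector [vector [0, 1 / of_int (k * l)],
    vector [1, - of_int (l - k) / of_int (k * l)]]"
  have "?A ** C = mat 1" "C ** ?A = mat 1"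
    using assms by (simp_all add: C_def incidence_matrix_def matrix_matrix_mult_def vec_eq_iff forall_2 sum_2 mat_def field_simps)
  then have "\<exists>C. ?A ** C = mat 1 \<and> C ** ?A = mat 1" by blast
  then have "?A ** ?B = mat 1 \<and> ?B ** ?A = mat 1"
    unfolding matrix_inv_def by (rule someI_ex)
  then have AB: "?A *v (?B *v g) = g" "?B *v (?A *v g) = g" for g
    by (simp_all add: matrix_vector_mul_assoc)
  have ABn: "((*v) ?A ^^ n) (((*v) ?B ^^ n) g) = g" "((*v) ?B ^^ n) (((*v) ?A ^^ n) g) = g" for n g
  proof (induction n arbitrary: g)
    case (Suc n)
    case 1
    show ?case by (subst funpow_Suc_right) (simp add: AB Suc)
    case 2
    show ?case by (subst funpow_Suc_right) (simp add: AB Suc)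
  qed simp_all
  show ?thesis
    unfolding dimension_group_def
  proof (intro equalityI subsetI)
    fix g assume "g \<in> (\<Union>n. ((*v) ?B ^^ n) ` {g. \<forall>i. g $ i \<in> \<int>})"
    then obtain n h where h: "g = ((*v) ?B ^^ n) h" "\<forall>i. h $ i \<in> \<int>" by blast
    then have "\<forall>i. (((*v) ?A ^^ n) g) $ i \<in> \<int>" by (simp add: ABn)
    then show "g \<in> {g. \<exists>n. \<forall>i. (((*v) ?A ^^ n) g) $ i \<in> \<int>}" by blast
  next
    fix g assume "g \<in> {g. \<exists>n. \<forall>i. (((*v) ?A ^^ n) g) $ i \<in> \<int>}"
    then obtain n where "\<forall>i. (((*v) ?A ^^ n) g) $ i \<in> \<int>" by blast
    then have "g \<in> ((*v) ?B ^^ n) ` {g. \<forall>i. g $ i \<in> \<int>}"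
      by (intro image_eqI[where x = "((*v) ?A ^^ n) g"]) (simp_all add: ABn)
    then show "g \<in> (\<Union>n. ((*v) ?B ^^ n) ` {g. \<forall>i. g $ i \<in> \<int>})" by blast
  qed
qed

text \<open>The isomorphism is the pair of eigencoordinates. It respects positivity because the
  first one is the functional that defines the order.\<close>

lemma dimension_group_isomorphic:
  assumes kl: "0 < k" "0 < l"
    and sum: "prime_factors (l + k) \<subseteq> prime_factors l \<inter> prime_factors k"
  shows "ordered_group_isomorphic
    (dimension_group (incidence_matrix k l)) (dimension_group_pos k l)
    (Z_inverse l \<times> Z_inverse k) {(x, y) \<in> Z_inverse l \<times> Z_inverse k. x > 0}"
proof -
  let ?G = "dimension_group (incidence_matrix k l)" and ?A = "rat_incidence_matrix k l"
  let ?f = "\<lambda>g. (eigen_coord l g, eigen_coord (- k) g)"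
  have G: "?G = {g. \<exists>n. \<forall>i. (((*v) ?A ^^ n) g) $ i \<in> \<int>}"
    using kl by (intro dimension_group_eq) auto
  note power = eigen_coord_incidence_matrix_power[of l k]
  have kl0: "rat_of_int k \<noteq> 0" "rat_of_int l \<noteq> 0" "rat_of_int k + rat_of_int l \<noteq> 0"
    using kl by (simp_all flip: of_int_add)
  have into: "?f g \<in> Z_inverse l \<times> Z_inverse k" if "g \<in> ?G" for g
  proof -
    obtain n where n: "\<forall>i. (((*v) ?A ^^ n) g) $ i \<in> \<int>" using \<open>g \<in> ?G\<close> unfolding G by blast
    let ?h = "((*v) ?A ^^ n) g"
    obtain a where a: "?h $ 1 = of_int a" using n[rule_format, of 1] by (rule Ints_cases)
    obtain b where b: "?h $ 2 = of_int b" using n[rule_format, of 2] by (rule Ints_cases)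
    note ab = a b
    have "of_int l ^ n * eigen_coord l g = of_int a + of_int b / of_int l"
      using power(1)[of n g] kl ab by (simp add: eigen_coord_def)
    then have "eigen_coord l g = of_int (a * l + b) / of_int l ^ Suc n"
      using kl0 by (simp add: field_simps)
    then have 1: "eigen_coord l g \<in> Z_inverse l" unfolding Z_inverse_def by blast
    \<comment> \<open>The eigenvalue is \<open>-k\<close>, but the denominators in
      \<open>Z_inverse k\<close> are powers of \<open>k\<close>; the sign \<open>(-1) ^ n\<close>
      moves into the numerator.\<close>
    have "of_int (- k) ^ n * eigen_coord (- k) g = of_int a - of_int b / of_int k"
      using power(2)[of n g] kl ab by (simp add: eigen_coord_def)
    moreover have "of_int (- k) ^ n = (- 1) ^ n * rat_of_int k ^ n"
      by (metis mult_minus1 of_int_minus power_mult_distrib)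
    ultimately have "(- 1) ^ n * of_int k ^ n * eigen_coord (- k) g = of_int a - of_int b / of_int k" by simp
    then have "(- 1) ^ n * ((- 1) ^ n * of_int k ^ n * eigen_coord (- k) g) = (- 1) ^ n * (of_int a - of_int b / of_int k)"
      by simp
    then have "of_int k ^ n * eigen_coord (- k) g = (- 1) ^ n * (of_int a - of_int b / of_int k)"
      by (simp flip: mult.assoc power_mult_distrib)
    then have "eigen_coord (- k) g = of_int ((- 1) ^ n * (a * k - b)) / of_int k ^ Suc n"
      using kl0 by (simp add: field_simps)
    then have "eigen_coord (- k) g \<in> Z_inverse k" unfolding Z_inverse_def by blast
    with 1 show ?thesis by simp
  qed
  have onto: "\<exists>g\<in>?G. ?f g = (x, y)" if xy: "x \<in> Z_inverse l" "y \<in> Z_inverse k" for x y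
  proof -
    obtain a p where x: "x = of_int a / of_int l ^ p" using xy(1) unfolding Z_inverse_def by blast
    obtain b q where y: "y = of_int b / of_int k ^ q" using xy(2) unfolding Z_inverse_def by blast
    have "prime_factors ((l + k) * l ^ p) \<subseteq> prime_factors l"
      using sum kl prime_factors_power_subset[of l p] by (auto simp: prime_factors_product)
    then have "\<forall>\<^sub>F n in sequentially. (l + k) * l ^ p dvd l ^ n"
      using kl by (intro eventually_dvd_power) auto
    moreover have "prime_factors ((l + k) * k ^ q) \<subseteq> prime_factors k"
      using sum kl prime_factors_power_subset[of k q] by (auto simp: prime_factors_product)
    then have "\<forall>\<^sub>F n in sequentially. (l + k) * k ^ q dvd k ^ n"
      using kl by (intro eventually_dvd_power) auto
    ultimately have "\<forall>\<^sub>F n in sequentially. (l + k) * l ^ p dvd l ^ n \<and> (l + k) * k ^ q dvd k ^ n"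
      by (rule eventually_conj)
    then obtain n where n: "(l + k) * l ^ p dvd l ^ n" "(l + k) * k ^ q dvd k ^ n"
      by (auto simp: eventually_sequentially)
    obtain u where u: "l ^ n = (l + k) * l ^ p * u" using n(1) by (elim dvdE)
    obtain v where v: "k ^ n = (l + k) * k ^ q * v" using n(2) by (elim dvdE)
    have u': "of_int l ^ n * x = (of_int l + of_int k) * of_int (u * a)"
      using arg_cong[OF u, of rat_of_int] kl0 by (simp add: x)
    have minus: "of_int (- k) ^ n = (- 1) ^ n * rat_of_int k ^ n"
      by (metis mult_minus1 of_int_minus power_mult_distrib)
    have v': "of_int (- k) ^ n * y = (of_int l + of_int k) * of_int ((- 1) ^ n * v * b)"
      unfolding minus y using arg_cong[OF v, of rat_of_int] kl0 by simp
    \<comment> \<open>\<open>g\<close> inverts the coordinate change. Its image \<open>h\<close>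
      after \<open>n\<close> steps is integral, since \<open>l ^ n * x\<close> and
      \<open>(-k) ^ n * y\<close> contain the factor \<open>l + k\<close> that cancels the
      denominator.\<close>
    define g :: "rat^2" where "g = vector [(of_int l * x + of_int k * y) / (of_int k + of_int l),
      of_int (k * l) * (x - y) / (of_int k + of_int l)]"
    have fg: "eigen_coord l g = x" "eigen_coord (- k) g = y"
      using kl0 by (simp_all add: eigen_coord_def g_def divide_simps) (simp_all add: algebra_simps)
    define h :: "rat^2" where "h = rat_vec (vector [l * (u * a) + k * ((- 1) ^ n * v * b),
      k * l * (u * a - (- 1) ^ n * v * b)])"
    have "((*v) ?A ^^ n) g = h"
    proof (rule eigen_coord_inject[of l k])
      show "eigen_coord l (((*v) ?A ^^ n) g) = eigen_coord l h"
        using kl kl0 by (simp add: power fg u' del: of_int_mult) (simp add: eigen_coord_def h_def rat_vec_def field_simps)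
      show "eigen_coord (- k) (((*v) ?A ^^ n) g) = eigen_coord (- k) h"
        using kl kl0 by (simp add: power fg v' del: of_int_mult of_int_minus)
          (simp add: eigen_coord_def h_def rat_vec_def field_simps)
    qed (use kl in auto)
    then have "g \<in> ?G" unfolding G by (auto intro!: exI[of _ n] simp: h_def rat_vec_def)
    then show ?thesis using fg by blast
  qed
  have "inj_on ?f ?G"
    by (rule inj_onI) (use kl eigen_coord_inject[of l k] in auto)
  moreover have "?f ` ?G = Z_inverse l \<times> Z_inverse k"
  proof (intro equalityI subsetI)
    fix z assume "z \<in> Z_inverse l \<times> Z_inverse k"
    then show "z \<in> ?f ` ?G" using onto[of "fst z" "snd z"] by (auto simp: image_iff)
  qed (use into in blast)
  ultimately have "bij_betw ?f ?G (Z_inverse l \<times> Z_inverse k)" by (simp add: bij_betw_def)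
  moreover have "g \<in> dimension_group_pos k l \<longleftrightarrow> ?f g \<in> {(x, y) \<in> Z_inverse l \<times> Z_inverse k. x > 0}"
    if "g \<in> ?G" for g
    using that into[OF that] by (simp add: dimension_group_pos_def eigen_coord_def)
  ultimately show ?thesis
    unfolding ordered_group_isomorphic_def
    by (intro exI[of _ ?f]) (simp add: eigen_coord_add)
qed

section \<open>Intertwining the two algebras\<close>

lemma isomorphic_of_prime_factors:
  assumes AF1: "AF_with_incidence_matrix TYPE('a::cstar_algebra) (incidence_matrix k1 l1) (axis 1 1)"
    and AF2: "AF_with_incidence_matrix TYPE('b::cstar_algebra) (incidence_matrix k2 l2) (axis 1 1)"
    and kl: "0 < k1" "k1 < l1" "0 < k2" "k2 < l2"
    and k: "prime_factors k1 = prime_factors k2" and l: "prime_factors l1 = prime_factors l2"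
    and sum: "prime_factors (l1 + k1) \<subseteq> prime_factors l1 \<inter> prime_factors k1"
      "prime_factors (l2 + k2) \<subseteq> prime_factors l2 \<inter> prime_factors k2"
  shows "cstar_isomorphic TYPE('a) TYPE('b)"
proof -
  have "\<forall>n. \<exists>m P. n < m \<and> (\<forall>i j. 0 < P $ i $ j) \<and> intertwines k1 l1 n k2 l2 m P"
    using ex_intertwines[of k1 l1 k2 l2] kl k l sum by blast
  then obtain M P where M: "\<And>n. n < M n" and P_pos: "\<And>n i j. 0 < P n $ i $ j"
    and P: "\<And>n. intertwines k1 l1 n k2 l2 (M n) (P n)" by metis
  have "\<forall>m. \<exists>n Q. m < n \<and> (\<forall>i j. 0 < Q $ i $ j) \<and> intertwines k2 l2 m k1 l1 n Q"
    using ex_intertwines[of k2 l2 k1 l1] kl k l sum by blast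
  then obtain N Q where N: "\<And>m. m < N m" and Q_pos: "\<And>m i j. 0 < Q m $ i $ j"
    and Q: "\<And>m. intertwines k2 l2 m k1 l1 (N m) (Q m)" by metis
  \<comment> \<open>Alternating the choices \<open>M\<close> and \<open>N\<close> makes the target
    level of each map the source level of the next one.\<close>
  define n where "n k = ((N \<circ> M) ^^ k) 0" for k
  have n_Suc: "n (Suc k) = N (M (n k))" for k by (simp add: n_def)
  have mono: "n k < n (Suc k)" "M (n k) < M (n (Suc k))" for k
    unfolding n_Suc using M N less_trans by blast+
  have pos: "0 < k1" "0 < l1" "0 < k2" "0 < l2" using kl by auto
  have J: "nonneg_mat (incidence_matrix k1 l1)" "nonneg_mat (incidence_matrix k2 l2)"
    using kl by (simp_all add: nonneg_mat_def incidence_matrix_def forall_2)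
  have u: "0 \<le> (axis 1 1 :: int^2) $ i" for i by (simp add: axis_def)
  show ?thesis
  proof (rule cstar_isomorphic_of_intertwining[OF AF1 AF2 J u u,
        where P = "\<lambda>k. P (n k)" and Q = "\<lambda>k. Q (M (n k))" and n = n and m = "\<lambda>k. M (n k)"])
    show "nonneg_mat (P (n k))" "nonneg_mat (Q (M (n k)))" for k
      using P_pos Q_pos by (simp_all add: nonneg_mat_def less_imp_le)
    show "\<exists>j. Q (M (n k)) $ j $ i > 0" for k i using Q_pos by blast
    show "strict_mono n" "strict_mono (\<lambda>k. M (n k))"
      using mono by (simp_all add: strict_mono_Suc_iff)
    show "P (n k) *v (((*v) (incidence_matrix k1 l1) ^^ n k) (axis 1 1))
        = ((*v) (incidence_matrix k2 l2) ^^ M (n k)) (axis 1 1)" for k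
      by (rule intertwines_unit[OF pos P])
    show "Q (M (n k)) *v (P (n k) *v x) = ((*v) (incidence_matrix k1 l1) ^^ (n (Suc k) - n k)) x" for k x
      by (rule intertwines_round_trip[OF pos P]) (use Q n_Suc mono(1)[of k] in \<open>simp_all add: less_imp_le\<close>)
    show "P (n (Suc k)) *v (Q (M (n k)) *v x)
        = ((*v) (incidence_matrix k2 l2) ^^ (M (n (Suc k)) - M (n k))) x" for k x
      by (rule intertwines_round_trip[OF pos(3,4,1,2) Q])
        (use P n_Suc[of k] mono(2)[of k] in \<open>simp_all add: less_imp_le flip: n_Suc\<close>)
  qed
qed

theorem proposition13p4:
  fixes k1 l1 k2 l2 :: int
  assumes "1 \<le> k1" and "k1 \<le> l1 - 1"
    and "1 \<le> k2" and "k2 \<le> l2 - 1"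
    and "prime_factors k1 = prime_factors k2"
    and "prime_factors l1 = prime_factors l2"
    and "prime_factors (l1 + k1) \<subseteq> prime_factors l1 \<inter> prime_factors k1"
    and "prime_factors (l2 + k2) \<subseteq> prime_factors l2 \<inter> prime_factors k2"
  shows "(AF_with_incidence_matrix TYPE('a::cstar_algebra) (incidence_matrix k1 l1) (axis 1 1) \<and>
          AF_with_incidence_matrix TYPE('b::cstar_algebra) (incidence_matrix k2 l2) (axis 1 1)
            \<longrightarrow> cstar_isomorphic TYPE('a) TYPE('b)) \<and>
         (\<forall>(k, l) \<in> {(k1, l1), (k2, l2)}.
            ordered_group_isomorphic
              (dimension_group (incidence_matrix k l)) (dimension_group_pos k l)
              (Z_inverse l1 \<times> Z_inverse k1) {(x, y) \<in> Z_inverse l1 \<times> Z_inverse k1. x > 0})"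
proof -
  have kl: "0 < k1" "k1 < l1" "0 < k2" "k2 < l2" using assms(1-4) by auto
  \<comment> \<open>Equal prime sets give the same rings, so \<open>l1\<close> and \<open>k1\<close>
    describe both dimension groups.\<close>
  have "Z_inverse l1 = Z_inverse l2" "Z_inverse k1 = Z_inverse k2"
    using assms(5,6) kl by (intro equalityI Z_inverse_subset; simp)+
  then show ?thesis
    using isomorphic_of_prime_factors[of k1 l1 k2 l2] dimension_group_isomorphic[of k1 l1]
      dimension_group_isomorphic[of k2 l2] kl assms(5-8) by auto
qed

end
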